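(* Let $\Omega\subset\mathbb{R}^d$ be a bounded domain and let $(\Omega_n)_{n\in\mathbb{N}}$ be a sequence of domains such that $$\forall n\in\mathbb{N},\ \Omega_n\subset\Omega,\qquad\text{and}\qquad \operatorname{meas}(\Omega\setminus\Omega_n)\to0\ \text{ as } n\to\infty,$$ where $\operatorname{meas}$ denotes Lebesgue measure. Then $$\limsup_{n\to\infty}\beta(\Omega_n)\le\beta(\Omega).$$
   Context: A domain is a nonempty connected open set. $L^2_\circ(\Omega)$ is the space of functions in $L^2(\Omega)$ with mean value zero; $\langle\cdot,\cdot\rangle_\Omega$ and $\|\cdot\|_{0,\Omega}$ are the $L^2(\Omega)$ scalar product and norm. $H^1_0(\Omega)$ is the closure of the smooth functions with compact support in $\Omega$ with respect to the $H^1$ seminorm; for vector functions $|\mathbf v|_{1,\Omega}=\|\nabla\mathbf v\|_{0,\Omega}=\big(\sum_{k,j=1}^d\|\partial_{x_j}v_k\|_{0,\Omega}^2\big)^{1/2}$. The inf-sup (LBB) constant of a domain $\Omega$ is $$\beta(\Omega)=\inf_{q\in L^2_\circ(\Omega)}\ \sup_{\mathbf v\in H^1_0(\Omega)^d}\frac{\langle \operatorname{div}\mathbf v,q\rangle_\Omega}{|\mathbf v|_{1,\Omega}\,\|q\|_{0,\Omega}},$$ with infimum and supremum over nonzero elements. *)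

theory Defs
  imports "HOL-Analysis.Analysis"
begin

text \<open>Throughout, functions on a set \<open>\<Omega>\<close> are total functions on \<open>real ^ 'd\<close> of which only the values
  on \<open>\<Omega>\<close> matter: integrals and almost-everywhere statements refer to \<^term>\<open>lebesgue_on \<Omega>\<close>,
  and functions are not quotiented by almost-everywhere equality.\<close>

definition domain :: "'a::topological_space set \<Rightarrow> bool" where
  "domain \<Omega> \<longleftrightarrow> \<Omega> \<noteq> {} \<and> open \<Omega> \<and> connected \<Omega>"

definition partial :: "'d::finite \<Rightarrow> (real ^ 'd \<Rightarrow> real) \<Rightarrow> real ^ 'd \<Rightarrow> real" where
  "partial j f x = frechet_derivative f (at x) (axis j 1)"

text \<open>Differentiability of all iterated partial derivatives gives continuity of all of them,
  hence \<open>C\<^sup>\<infinity>\<close>; the case \<open>js = []\<close> is differentiability of \<open>f\<close> itself.\<close>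

definition smooth :: "(real ^ 'd::finite \<Rightarrow> real) \<Rightarrow> bool" where
  "smooth f \<longleftrightarrow> (\<forall>js x. fold partial js f differentiable (at x))"

definition test_functions :: "(real ^ 'd::finite) set \<Rightarrow> (real ^ 'd \<Rightarrow> real) set" where
  "test_functions \<Omega> =
     {\<phi>. smooth \<phi> \<and> compact (closure {x. \<phi> x \<noteq> 0}) \<and> closure {x. \<phi> x \<noteq> 0} \<subseteq> \<Omega>}"

definition L2 :: "(real ^ 'd::finite) set \<Rightarrow> (real ^ 'd \<Rightarrow> real) set" where
  "L2 \<Omega> = {f. f \<in> borel_measurable (lebesgue_on \<Omega>) \<and> integrable (lebesgue_on \<Omega>) (\<lambda>x. (f x)\<^sup>2)}"

definition L2_inner :: "(real ^ 'd::finite) set \<Rightarrow> (real ^ 'd \<Rightarrow> real) \<Rightarrow> (real ^ 'd \<Rightarrow> real) \<Rightarrow> real" where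
  "L2_inner \<Omega> f g = (LINT x|lebesgue_on \<Omega>. f x * g x)"

definition L2_norm :: "(real ^ 'd::finite) set \<Rightarrow> (real ^ 'd \<Rightarrow> real) \<Rightarrow> real" where
  "L2_norm \<Omega> f = sqrt (L2_inner \<Omega> f f)"

text \<open>Meant for \<open>\<Omega>\<close> of finite measure, where every element of \<^term>\<open>L2 \<Omega>\<close> is integrable.\<close>

definition L2_mean_zero :: "(real ^ 'd::finite) set \<Rightarrow> (real ^ 'd \<Rightarrow> real) set" where
  "L2_mean_zero \<Omega> = {q \<in> L2 \<Omega>. (LINT x|lebesgue_on \<Omega>. q x) = 0}"

definition has_weak_partial ::
    "(real ^ 'd::finite) set \<Rightarrow> 'd \<Rightarrow> (real ^ 'd \<Rightarrow> real) \<Rightarrow> (real ^ 'd \<Rightarrow> real) \<Rightarrow> bool" where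
  "has_weak_partial \<Omega> j u w \<longleftrightarrow> u \<in> L2 \<Omega> \<and> w \<in> L2 \<Omega> \<and>
     (\<forall>\<phi>\<in>test_functions \<Omega>. L2_inner \<Omega> u (partial j \<phi>) = - L2_inner \<Omega> w \<phi>)"

definition H1 :: "(real ^ 'd::finite) set \<Rightarrow> (real ^ 'd \<Rightarrow> real) set" where
  "H1 \<Omega> = {u \<in> L2 \<Omega>. \<forall>j. \<exists>w. has_weak_partial \<Omega> j u w}"

text \<open>For open \<open>\<Omega>\<close> the weak derivative is unique up to a null set, so the choice below does not
  affect any integral formed from it.\<close>

definition weak_partial :: "(real ^ 'd::finite) set \<Rightarrow> 'd \<Rightarrow> (real ^ 'd \<Rightarrow> real) \<Rightarrow> real ^ 'd \<Rightarrow> real" where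
  "weak_partial \<Omega> j u = (SOME w. has_weak_partial \<Omega> j u w)"

definition H1_seminorm :: "(real ^ 'd::finite) set \<Rightarrow> (real ^ 'd \<Rightarrow> real) \<Rightarrow> real" where
  "H1_seminorm \<Omega> u = sqrt (\<Sum>j\<in>UNIV. (L2_norm \<Omega> (weak_partial \<Omega> j u))\<^sup>2)"

text \<open>The seminorm alone does not separate points of \<^term>\<open>H1 \<Omega>\<close> (it vanishes on constants), so the
  closure of the test functions in the seminorm has to be read as their completion. On bounded
  \<open>\<Omega>\<close>, Poincare's inequality makes every seminorm-Cauchy sequence of test functions convergent
  in \<^term>\<open>L2 \<Omega>\<close>, and the completion consists of the functions that are limits both
  in \<^term>\<open>L2 \<Omega>\<close> and in the seminorm.\<close>

definition H1_0 :: "(real ^ 'd::finite) set \<Rightarrow> (real ^ 'd \<Rightarrow> real) set" where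
  "H1_0 \<Omega> = {u \<in> H1 \<Omega>. \<exists>\<phi>. (\<forall>n::nat. \<phi> n \<in> test_functions \<Omega>) \<and>
      (\<lambda>n. L2_norm \<Omega> (\<lambda>x. u x - \<phi> n x)) \<longlonglongrightarrow> 0 \<and>
      (\<lambda>n. H1_seminorm \<Omega> (\<lambda>x. u x - \<phi> n x)) \<longlonglongrightarrow> 0}"

definition H1_0_vec :: "(real ^ 'd::finite) set \<Rightarrow> (real ^ 'd \<Rightarrow> real ^ 'd) set" where
  "H1_0_vec \<Omega> = {v. \<forall>k. (\<lambda>x. v x $ k) \<in> H1_0 \<Omega>}"

definition H1_seminorm_vec :: "(real ^ 'd::finite) set \<Rightarrow> (real ^ 'd \<Rightarrow> real ^ 'd) \<Rightarrow> real" where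
  "H1_seminorm_vec \<Omega> v =
     sqrt (\<Sum>k\<in>UNIV. \<Sum>j\<in>UNIV. (L2_norm \<Omega> (weak_partial \<Omega> j (\<lambda>x. v x $ k)))\<^sup>2)"

definition weak_div :: "(real ^ 'd::finite) set \<Rightarrow> (real ^ 'd \<Rightarrow> real ^ 'd) \<Rightarrow> real ^ 'd \<Rightarrow> real" where
  "weak_div \<Omega> v x = (\<Sum>k\<in>UNIV. weak_partial \<Omega> k (\<lambda>y. v y $ k) x)"

definition nonzero_on :: "(real ^ 'd::finite) set \<Rightarrow> (real ^ 'd \<Rightarrow> 'b::zero) \<Rightarrow> bool" where
  "nonzero_on \<Omega> f \<longleftrightarrow> \<not> (AE x in lebesgue_on \<Omega>. f x = 0)"

text \<open>The infimum and the supremum are taken in the complete lattice \<^typ>\<open>ereal\<close>.\<close>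

definition inf_sup_constant :: "(real ^ 'd::finite) set \<Rightarrow> ereal" where
  "inf_sup_constant \<Omega> =
     (INF q\<in>{q \<in> L2_mean_zero \<Omega>. nonzero_on \<Omega> q}.
      SUP v\<in>{v \<in> H1_0_vec \<Omega>. nonzero_on \<Omega> v}.
        ereal (L2_inner \<Omega> (weak_div \<Omega> v) q / (H1_seminorm_vec \<Omega> v * L2_norm \<Omega> q)))"

end

theory Submission
  imports Defs "HOL-Computational_Algebra.Polynomial"
begin

text \<open>Fix a nonzero mean-zero \<open>q\<close> on \<open>\<Omega>\<close> and subtract from \<open>q\<close> its mean over \<open>\<Omega>\<^sub>n\<close>. An element \<open>v\<close>
  of \<open>H\<^sup>1\<^sub>0(\<Omega>\<^sub>n)\<close> extends by zero to \<open>H\<^sup>1\<^sub>0(\<Omega>)\<close> with the same seminorm, and the integral of \<open>div v\<close> vanishes,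
  so the correction of \<open>q\<close> does not change \<open>\<langle>div v, q\<rangle>\<close>. Hence the quotient of \<open>v\<close> on \<open>\<Omega>\<^sub>n\<close> is the
  quotient of its extension on \<open>\<Omega>\<close> times the ratio of the norms of \<open>q\<close> and the corrected \<open>q\<close>, and
  this ratio tends to 1 because the missing measure tends to 0. Extension by zero needs weak
  derivatives to be unique almost everywhere; this holds because indicators of boxes are bounded
  pointwise limits of test functions.\<close>

section \<open>Bump functions\<close>

text \<open>\<open>weak_partial\<close> is a choice made separately on each set, and functions have
  arbitrary values off their set. The derivatives of a function and of its zero extension are
  therefore two unrelated choices, comparable only almost everywhere; this is why a uniqueness
  result must precede every statement about extension. Since \<open>smooth\<close> asks for all
  iterated partial derivatives, the test functions behind it are built explicitly. The approximants
  of \<open>v\<close> live in the small set, while the functions they are tested against live in the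
  large one. Integration by parts is therefore proved with compact support on one factor only;
  taking the other factor to be 1 shows that the divergence has integral 0. The correction of
  \<open>q\<close> fades out because the integral of \<open>q\<close> over the small sets tends to
  its integral over \<open>\<Omega>\<close>, which is 0. Only one inequality results, because
  elements of the velocity space extend from the small set but do not restrict to it.\<close>

text \<open>The derivatives of \<open>exp (- 1 / t)\<close> are again of the form \<open>p (1 / t) exp (- 1 / t)\<close>, so a
  class of functions closed under partial derivatives contains the test functions needed.\<close>

definition flat :: "real poly \<Rightarrow> real \<Rightarrow> real" where
  "flat p t = (if t > 0 then poly p (1 / t) * exp (- (1 / t)) else 0)"

lemma poly_times_exp_neg_tendsto_0:
  fixes p :: "real poly"
  shows "((\<lambda>s. poly p s * exp (- s)) \<longlongrightarrow> 0) at_top"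
proof -
  have "((\<lambda>s. \<Sum>i\<le>degree p. coeff p i * (s ^ i / exp s)) \<longlongrightarrow> (\<Sum>i\<le>degree p. coeff p i * 0)) at_top"
    by (intro tendsto_sum tendsto_mult tendsto_const tendsto_power_div_exp_0)
  then show ?thesis
    by (simp add: poly_altdef sum_divide_distrib exp_minus divide_inverse mult.assoc sum_distrib_right)
qed

text \<open>Substituting s = 1 / t turns the right-hand limit into the decay of a polynomial times
  exp (- s) at infinity.\<close>

lemma flat_tendsto_0: "(flat p \<longlongrightarrow> 0) (at 0)"
proof -
  have "((\<lambda>t. poly p (1 / t) * exp (- (1 / t))) \<longlongrightarrow> 0) (at_right 0)"
    using filterlim_compose[OF poly_times_exp_neg_tendsto_0[of p] filterlim_inverse_at_top_right]
    by (simp add: inverse_eq_divide)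
  then have "(flat p \<longlongrightarrow> 0) (at_right 0)"
    by (rule Lim_transform_eventually)
       (auto simp: flat_def eventually_at_right_field intro!: exI[of _ 1])
  moreover have "(flat p \<longlongrightarrow> 0) (at_left 0)"
    by (rule Lim_transform_eventually[OF tendsto_const])
       (auto simp: flat_def eventually_at_left_field intro!: exI[of _ "-1"])
  ultimately show ?thesis
    by (simp add: filterlim_split_at)
qed

text \<open>With s = 1 / t one has d/dt = - s^2 d/ds, which sends p(s) exp (- s) to s^2 (p - p')(s)
  exp (- s); \<open>monom 1 2\<close> is the factor s^2. At 0 the difference quotient is again a
  \<open>flat\<close> function and tends to 0.\<close>

lemma flat_has_derivative:
  "(flat p has_real_derivative flat (monom 1 2 * (p - pderiv p)) t) (at t)"
proof -
  consider "t > 0" | "t < 0" | "t = 0" by linarith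
  then show ?thesis
  proof cases
    case 1
    have "((\<lambda>t. poly p (1 / t) * exp (- (1 / t))) has_real_derivative
            flat (monom 1 2 * (p - pderiv p)) t) (at t)"
      using 1
      by (auto intro!: derivative_eq_intros DERIV_chain2[OF poly_DERIV]
               simp: flat_def poly_monom field_simps power2_eq_square)
    then show ?thesis
      by (rule has_field_derivative_transform_within_open[where S = "{0<..}"])
         (use 1 in \<open>auto simp: flat_def\<close>)
  next
    case 2
    have "((\<lambda>t. 0) has_real_derivative flat (monom 1 2 * (p - pderiv p)) t) (at t)"
      using 2 by (simp add: flat_def)
    then show ?thesis
      by (rule has_field_derivative_transform_within_open[where S = "{..<0}"])
         (use 2 in \<open>auto simp: flat_def\<close>)
  next
    case 3
    \<comment> \<open>Dividing by h multiplies the polynomial in 1 / h by its variable, which is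
      \<open>pCons 0 p\<close>; at h = 0 both sides are 0.\<close>
    have "(\<lambda>h. (flat p h - flat p 0) / (h - 0)) = flat (pCons 0 p)"
      by (simp add: flat_def fun_eq_iff)
    moreover have "flat (monom 1 2 * (p - pderiv p)) 0 = 0"
      by (simp add: flat_def)
    ultimately show ?thesis
      using flat_tendsto_0[of "pCons 0 p"] 3
      by (simp only: has_field_derivative_iff)
  qed
qed

lemma flat_1_bounds: "0 \<le> flat 1 t" "flat 1 t \<le> 1"
  by (auto simp: flat_def)

lemma flat_1_tendsto: "(flat 1 \<longlongrightarrow> 1) at_top"
proof -
  have "((\<lambda>t::real. exp (- (1 / t))) \<longlongrightarrow> exp (- 0)) at_top"
    by (intro tendsto_intros tendsto_divide_0[OF tendsto_const] filterlim_at_top_imp_at_infinity filterlim_ident)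
  then have "((\<lambda>t::real. exp (- (1 / t))) \<longlongrightarrow> 1) at_top" by simp
  then show ?thesis
    by (rule Lim_transform_eventually)
       (auto simp: flat_def eventually_at_top_linorder intro!: exI[of _ 1])
qed

text \<open>The shift by -1 makes the function vanish for all t up to 1 / Suc n, which keeps the
  supports of the bumps built from it away from the boundary of a box.\<close>

lemma flat_1_dilation_tendsto: "(\<lambda>n. flat 1 (real (Suc n) * t - 1)) \<longlonglongrightarrow> of_bool (t > 0)"
proof (cases "t > 0")
  case True
  have "filterlim (\<lambda>n. - 1 + t * real (Suc n)) at_top sequentially"
    by (intro filterlim_tendsto_add_at_top[OF tendsto_const]
          filterlim_tendsto_pos_mult_at_top[OF tendsto_const True]
          filterlim_compose[OF filterlim_real_sequentially filterlim_Suc])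
  from filterlim_compose[OF flat_1_tendsto this] show ?thesis
    using True by (simp add: algebra_simps)
next
  case False
  then have "real (Suc n) * t \<le> 0" for n
    by (simp add: mult_le_0_iff)
  then have "flat 1 (real (Suc n) * t - 1) = 0" for n
    by (smt (verit) flat_def)
  then show ?thesis using False by simp
qed

lemma partial_eq:
  assumes "(f has_derivative f') (at x)"
  shows "partial j f x = f' (axis j 1)"
  using frechet_derivative_at[OF assms] by (simp add: partial_def)

text \<open>Members are differentiable and their partial derivatives are members, so an induction
  over the list in \<open>smooth\<close> suffices. The affine argument of \<open>flat\<close> allows
  reflections, hence both faces of a box in each direction; constants arise as inner
  derivatives.\<close>

inductive_set flat_algebra :: "(real ^ 'd::finite \<Rightarrow> real) set" where
  const: "(\<lambda>x. c) \<in> flat_algebra"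
| flat: "(\<lambda>x. flat p (a * x $ i + b)) \<in> flat_algebra"
| add: "f \<in> flat_algebra \<Longrightarrow> g \<in> flat_algebra \<Longrightarrow> (\<lambda>x. f x + g x) \<in> flat_algebra"
| mult: "f \<in> flat_algebra \<Longrightarrow> g \<in> flat_algebra \<Longrightarrow> (\<lambda>x. f x * g x) \<in> flat_algebra"

lemma flat_algebra_partial:
  assumes "f \<in> flat_algebra"
  shows "(\<forall>x. f differentiable (at x)) \<and> (\<forall>j. partial j f \<in> flat_algebra)"
  using assms
proof induction
  case (const c)
  have "partial j (\<lambda>x. c) = (\<lambda>x. 0)" for j :: 'a
    by (simp add: partial_def fun_eq_iff)
  then show ?case by (simp add: flat_algebra.const)
next
  case (flat p a i b)
  let ?q = "monom 1 2 * (p - pderiv p)"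
  have D: "((\<lambda>x::real^'a. flat p (a * x $ i + b)) has_derivative
             (\<lambda>h. flat ?q (a * x $ i + b) * (a * h $ i))) (at x)" for x
    by (rule has_derivative_eq_rhs, rule has_derivative_compose[where g = "flat p",
          OF _ flat_has_derivative[unfolded has_field_derivative_def]])
       (auto intro!: derivative_eq_intros bounded_linear_imp_has_derivative bounded_linear_vec_nth simp: fun_eq_iff)
  have "partial j (\<lambda>x. flat p (a * x $ i + b)) = (\<lambda>x. flat ?q (a * x $ i + b) * (a * axis j 1 $ i))" for j
    by (simp add: fun_eq_iff partial_eq[OF D])
  then show ?case
    using D by (auto simp: differentiable_def intro!: flat_algebra.intros)
next
  case (add f g)
  have "partial j (\<lambda>x. f x + g x) = (\<lambda>x. partial j f x + partial j g x)" for j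
  proof
    fix x
    show "partial j (\<lambda>x. f x + g x) x = partial j f x + partial j g x"
      using partial_eq[OF has_derivative_add[of f "frechet_derivative f (at x)" "at x" g "frechet_derivative g (at x)"]]
        add by (simp add: partial_def frechet_derivative_works)
  qed
  then show ?case
    using add by (auto intro!: flat_algebra.intros)
next
  case (mult f g)
  have "partial j (\<lambda>x. f x * g x) = (\<lambda>x. f x * partial j g x + partial j f x * g x)" for j
  proof
    fix x
    show "partial j (\<lambda>x. f x * g x) x = f x * partial j g x + partial j f x * g x"
      using partial_eq[OF has_derivative_mult[of f "frechet_derivative f (at x)" x UNIV g "frechet_derivative g (at x)"]]
        mult by (simp add: partial_def frechet_derivative_works)
  qed
  then show ?case
    using mult by (auto intro!: flat_algebra.intros)
qed

lemma flat_algebra_smooth: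
  assumes "f \<in> flat_algebra"
  shows "smooth f"
proof -
  \<comment> \<open>\<open>fold\<close> applies the head of the list first, so \<open>f\<close> must
    vary in the induction.\<close>
  have "fold partial js f \<in> flat_algebra" for js
    using assms by (induction js arbitrary: f) (auto simp: flat_algebra_partial)
  then show ?thesis
    by (auto simp: smooth_def flat_algebra_partial)
qed

lemma flat_algebra_prod:
  assumes "finite I" "\<And>i. i \<in> I \<Longrightarrow> f i \<in> flat_algebra"
  shows "(\<lambda>x. \<Prod>i\<in>I. f i x) \<in> flat_algebra"
  using assms by (induction I) (auto intro: flat_algebra.intros)

text \<open>Each factor of the product switches on at distance 1 / Suc n from one face. The bound 1
  and the vanishing outside the box supply the majorant when orthogonality passes from test
  functions to box indicators.\<close>

lemma box_indicator_limit_of_test_functions: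
  fixes a b :: "real ^ 'd::finite"
  assumes "box a b \<subseteq> \<Omega>"
  obtains \<phi> :: "nat \<Rightarrow> real ^ 'd \<Rightarrow> real"
  where "\<And>n. \<phi> n \<in> test_functions \<Omega>" "\<And>n x. \<bar>\<phi> n x\<bar> \<le> 1"
    "\<And>n x. x \<notin> box a b \<Longrightarrow> \<phi> n x = 0"
    "\<And>x. (\<lambda>n. \<phi> n x) \<longlonglongrightarrow> indicator (box a b) x"
proof
  let ?\<phi> = "\<lambda>n x. \<Prod>i\<in>UNIV. flat 1 (real (Suc n) * (x $ i - a $ i) - 1) *
      flat 1 (real (Suc n) * (b $ i - x $ i) - 1)"
  \<comment> \<open>The box with every face moved inwards by 1 / Suc n. Being closed, it contains
    the closure of the nonvanishing set, so the support stays off the boundary.\<close>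
  define K where "K n = cbox (\<chi> i. a $ i + 1 / real (Suc n)) (\<chi> i. b $ i - 1 / real (Suc n))" for n
  have K: "K n \<subseteq> box a b" for n
  proof
    fix x assume "x \<in> K n"
    then have "a $ i + 1 / real (Suc n) \<le> x $ i \<and> x $ i \<le> b $ i - 1 / real (Suc n)" for i
      by (simp add: K_def mem_box_cart del: of_nat_Suc)
    moreover have "1 / real (Suc n) > 0" by simp
    ultimately have "a $ i < x $ i \<and> x $ i < b $ i" for i
      by (smt (verit))
    then show "x \<in> box a b" by (simp add: mem_box_cart)
  qed
  have supp: "{x. ?\<phi> n x \<noteq> 0} \<subseteq> K n" for n
  proof
    fix x assume "x \<in> {x. ?\<phi> n x \<noteq> 0}"
    then have "real (Suc n) * (x $ i - a $ i) - 1 > 0" "real (Suc n) * (b $ i - x $ i) - 1 > 0" for i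
      by (auto simp: flat_def split: if_splits)
    then show "x \<in> K n"
      by (simp add: K_def mem_box_cart field_simps less_imp_le del: of_nat_Suc)
  qed
  then show "?\<phi> n x = 0" if "x \<notin> box a b" for n x
    using that K by blast
  have supp': "closure {x. ?\<phi> n x \<noteq> 0} \<subseteq> K n" for n
    using supp[of n] unfolding K_def by (rule closure_minimal[OF _ closed_cbox])
  have "(\<lambda>x. flat 1 (real (Suc n) * (x $ i - a $ i) - 1) *
      flat 1 (real (Suc n) * (b $ i - x $ i) - 1)) \<in> flat_algebra" for n i
    using flat_algebra.mult[OF flat_algebra.flat[of 1 "real (Suc n)" i "- real (Suc n) * a $ i - 1"]
        flat_algebra.flat[of 1 "- real (Suc n)" i "real (Suc n) * b $ i - 1"]]
    by (simp add: algebra_simps)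
  then have "smooth (?\<phi> n)" for n
    by (intro flat_algebra_smooth flat_algebra_prod) auto
  moreover have "compact (closure {x. ?\<phi> n x \<noteq> 0})" for n
    using supp'[of n] unfolding compact_eq_bounded_closed K_def
    by (auto intro: bounded_subset[OF bounded_cbox])
  ultimately show "?\<phi> n \<in> test_functions \<Omega>" for n
    using order_trans[OF supp'[of n] order_trans[OF K[of n] assms]]
    by (simp only: test_functions_def mem_Collect_eq simp_thms)
  show "\<bar>?\<phi> n x\<bar> \<le> 1" for n x
    unfolding abs_prod
    by (intro prod_le_1) (simp add: abs_mult flat_1_bounds mult_le_one)
  show "(\<lambda>n. ?\<phi> n x) \<longlonglongrightarrow> indicator (box a b) x" for x
  proof -
    have "(\<lambda>n. ?\<phi> n x) \<longlonglongrightarrow>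
        (\<Prod>i\<in>UNIV. of_bool (x $ i - a $ i > 0) * of_bool (b $ i - x $ i > 0))"
      by (intro tendsto_prod tendsto_mult flat_1_dilation_tendsto)
    also have "(\<Prod>i\<in>UNIV. of_bool (x $ i - a $ i > 0) * of_bool (b $ i - x $ i > 0))
        = (indicator (box a b) x :: real)"
      by (auto simp: indicator_def mem_box_cart)
    finally show ?thesis .
  qed
qed

section \<open>Square integrable functions\<close>

text \<open>Discriminant argument: the integral of (f - t g)^2 is a nonnegative quadratic polynomial
  in t.\<close>

lemma cauchy_schwarz_lebesgue_integral:
  fixes f g :: "'a \<Rightarrow> real"
  assumes [measurable]: "f \<in> borel_measurable M" "g \<in> borel_measurable M"
    and f: "integrable M (\<lambda>x. (f x)\<^sup>2)" and g: "integrable M (\<lambda>x. (g x)\<^sup>2)"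
  shows "integrable M (\<lambda>x. f x * g x)" (is ?int)
    and "(LINT x|M. f x * g x)\<^sup>2 \<le> (LINT x|M. (f x)\<^sup>2) * (LINT x|M. (g x)\<^sup>2)" (is ?le)
proof -
  have "\<bar>a * b\<bar> \<le> a\<^sup>2 + b\<^sup>2" for a b :: real
    using sum_squares_bound[of a b] sum_squares_bound[of a "- b"] zero_le_power2[of a] zero_le_power2[of b]
    by (auto simp: abs_le_iff)
  then show int: ?int
    by (intro Bochner_Integration.integrable_bound[OF Bochner_Integration.integrable_add[OF f g]])
       (auto intro!: AE_I2)
  define A B C where "A = (LINT x|M. (f x)\<^sup>2)" and "B = (LINT x|M. (g x)\<^sup>2)"
    and "C = (LINT x|M. f x * g x)"
  have quadratic: "0 \<le> A - 2 * t * C + t\<^sup>2 * B" for t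
  proof -
    have "0 \<le> (LINT x|M. (f x - t * g x)\<^sup>2)"
      by simp
    also have "\<dots> = (LINT x|M. (f x)\<^sup>2 - 2 * t * (f x * g x) + t\<^sup>2 * (g x)\<^sup>2)"
      by (simp add: power2_eq_square algebra_simps)
    also have "\<dots> = A - 2 * t * C + t\<^sup>2 * B"
      using f g int by (simp add: A_def B_def C_def)
    finally show ?thesis .
  qed
  have "C\<^sup>2 \<le> A * B"
  proof (cases "B = 0")
    case True
    \<comment> \<open>For nonzero \<open>C\<close> the value at t = (A + 1) / (2 C) would be
      -1.\<close>
    have "C = 0"
      using quadratic[of "(A + 1) / (2 * C)"] True by (cases "C = 0") auto
    then show ?thesis using True by simp
  next
    case False
    have "B \<ge> 0" by (simp add: B_def)
    \<comment> \<open>The quadratic is minimal at t = C / B.\<close>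
    with False show ?thesis
      using quadratic[of "C / B"] by (simp add: field_simps power2_eq_square)
  qed
  then show ?le by (simp add: A_def B_def C_def)
qed

lemma L2_inner_integrable:
  assumes "f \<in> L2 \<Omega>" "g \<in> L2 \<Omega>"
  shows "integrable (lebesgue_on \<Omega>) (\<lambda>x. f x * g x)"
  using assms cauchy_schwarz_lebesgue_integral(1) by (auto simp: L2_def)

lemma L2_inner_commute: "L2_inner \<Omega> f g = L2_inner \<Omega> g f"
  by (simp add: L2_inner_def mult.commute)

lemma L2_norm_power2: "(L2_norm \<Omega> f)\<^sup>2 = (LINT x|lebesgue_on \<Omega>. (f x)\<^sup>2)"
  by (simp add: L2_norm_def L2_inner_def power2_eq_square[symmetric])

lemma L2_norm_nonneg: "0 \<le> L2_norm \<Omega> f"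
  by (simp add: L2_norm_def L2_inner_def)

lemma L2_inner_le_norms:
  assumes "f \<in> L2 \<Omega>" "g \<in> L2 \<Omega>"
  shows "\<bar>L2_inner \<Omega> f g\<bar> \<le> L2_norm \<Omega> f * L2_norm \<Omega> g"
proof -
  have "(L2_inner \<Omega> f g)\<^sup>2 \<le> (L2_norm \<Omega> f * L2_norm \<Omega> g)\<^sup>2"
    using assms cauchy_schwarz_lebesgue_integral(2)
    by (auto simp: L2_def L2_norm_power2 power_mult_distrib L2_inner_def)
  then show ?thesis
    by (metis L2_norm_nonneg abs_le_square_iff abs_of_nonneg mult_nonneg_nonneg)
qed

lemma L2_diff:
  assumes "f \<in> L2 \<Omega>" "g \<in> L2 \<Omega>"
  shows "(\<lambda>x. f x - g x) \<in> L2 \<Omega>"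
proof -
  have "integrable (lebesgue_on \<Omega>) (\<lambda>x. (f x)\<^sup>2 + (g x)\<^sup>2 - 2 * (f x * g x))"
    using assms L2_inner_integrable[OF assms] by (auto simp: L2_def)
  then show ?thesis
    using assms by (auto simp: L2_def power2_eq_square algebra_simps)
qed

lemma L2_inner_diff_left:
  assumes "f \<in> L2 \<Omega>" "g \<in> L2 \<Omega>" "h \<in> L2 \<Omega>"
  shows "L2_inner \<Omega> (\<lambda>x. f x - g x) h = L2_inner \<Omega> f h - L2_inner \<Omega> g h"
  using L2_inner_integrable[OF assms(1,3)] L2_inner_integrable[OF assms(2,3)]
  by (simp add: L2_inner_def left_diff_distrib)

text \<open>By Cauchy-Schwarz. This carries identities from approximating test functions to elements
  of \<open>H1_0\<close>.\<close>

lemma L2_inner_tendsto: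
  assumes "u \<in> L2 \<Omega>" "\<And>n. f n \<in> L2 \<Omega>" "g \<in> L2 \<Omega>"
    and lim: "(\<lambda>n. L2_norm \<Omega> (\<lambda>x. u x - f n x)) \<longlonglongrightarrow> 0"
  shows "(\<lambda>n. L2_inner \<Omega> (f n) g) \<longlonglongrightarrow> L2_inner \<Omega> u g"
proof (rule Lim_null_comparison[THEN LIM_zero_cancel])
  show "\<forall>\<^sub>F n in sequentially. norm (L2_inner \<Omega> (f n) g - L2_inner \<Omega> u g)
      \<le> L2_norm \<Omega> (\<lambda>x. u x - f n x) * L2_norm \<Omega> g"
    using L2_inner_le_norms[OF L2_diff[OF assms(1,2)] assms(3)]
    by (auto simp: L2_inner_diff_left assms abs_minus_commute)
  show "(\<lambda>n. L2_norm \<Omega> (\<lambda>x. u x - f n x) * L2_norm \<Omega> g) \<longlonglongrightarrow> 0"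
    using lim by (rule tendsto_mult_left_zero)
qed

lemma L2_norm_cong_AE:
  assumes "f \<in> borel_measurable (lebesgue_on \<Omega>)" "g \<in> borel_measurable (lebesgue_on \<Omega>)"
    and "AE x in lebesgue_on \<Omega>. f x = g x"
  shows "L2_norm \<Omega> f = L2_norm \<Omega> g"
proof -
  have "(LINT x|lebesgue_on \<Omega>. f x * f x) = (LINT x|lebesgue_on \<Omega>. g x * g x)"
    using assms by (intro integral_cong_AE borel_measurable_times) auto
  then show ?thesis by (simp add: L2_norm_def L2_inner_def)
qed

lemma L2_const:
  assumes "\<Omega> \<in> lmeasurable"
  shows "(\<lambda>x. c) \<in> L2 \<Omega>"
  using assms by (simp add: L2_def integrable_restrict_space fmeasurableD lmeasurable_iff_integrable)

text \<open>Values off \<open>S\<close> are arbitrary in this setting, hence must be reset before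
  \<open>f\<close> is viewed on a larger set. The codomain is general because scalar functions and
  vector fields are both extended.\<close>

definition zero_extend :: "'a set \<Rightarrow> ('a \<Rightarrow> 'b::zero) \<Rightarrow> 'a \<Rightarrow> 'b" where
  "zero_extend S f x = (if x \<in> S then f x else 0)"

context
  fixes S T :: "'a::euclidean_space set"
  assumes S: "S \<in> sets lebesgue" and T: "T \<in> sets lebesgue" and ST: "S \<subseteq> T"
begin

text \<open>Restricted measures reduce to \<open>lebesgue\<close> with an indicator factor, and this
  identity makes the two reduced integrands equal as functions.\<close>

lemma indicator_zero_extend:
  fixes f :: "'a \<Rightarrow> real"
  shows "(\<lambda>x. indicator T x *\<^sub>R zero_extend S f x) = (\<lambda>x. indicator S x *\<^sub>R f x)"
  using ST by (auto simp: zero_extend_def indicator_def fun_eq_iff)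

lemma zero_extend_measurable:
  fixes f :: "'a \<Rightarrow> real"
  shows "zero_extend S f \<in> borel_measurable (lebesgue_on T) \<longleftrightarrow> f \<in> borel_measurable (lebesgue_on S)"
  using S T by (simp add: borel_measurable_restrict_space_iff indicator_zero_extend del: real_scaleR_def)

lemma zero_extend_integrable:
  fixes f :: "'a \<Rightarrow> real"
  shows "integrable (lebesgue_on T) (zero_extend S f) \<longleftrightarrow> integrable (lebesgue_on S) f"
  using S T by (simp add: integrable_restrict_space indicator_zero_extend del: real_scaleR_def)

lemma zero_extend_integral:
  fixes f :: "'a \<Rightarrow> real"
  shows "(LINT x|lebesgue_on T. zero_extend S f x) = (LINT x|lebesgue_on S. f x)"
  using S T by (simp add: integral_restrict_space indicator_zero_extend del: real_scaleR_def)

lemma zero_extend_AE: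
  fixes f g :: "'a \<Rightarrow> 'b::zero"
  shows "(AE x in lebesgue_on T. zero_extend S f x = zero_extend S g x) \<longleftrightarrow> (AE x in lebesgue_on S. f x = g x)"
proof -
  have "(\<lambda>x. x \<in> T \<longrightarrow> zero_extend S f x = zero_extend S g x) = (\<lambda>x. x \<in> S \<longrightarrow> f x = g x)"
    using ST by (auto simp: zero_extend_def fun_eq_iff)
  then have "(AE x in lebesgue. x \<in> T \<longrightarrow> zero_extend S f x = zero_extend S g x) \<longleftrightarrow>
      (AE x in lebesgue. x \<in> S \<longrightarrow> f x = g x)"
    by (rule arg_cong)
  then show ?thesis
    using S T by (simp add: AE_restrict_space_iff)
qed

end

context
  fixes S T :: "(real ^ 'd::finite) set"
  assumes S: "S \<in> sets lebesgue" and T: "T \<in> sets lebesgue" and ST: "S \<subseteq> T"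
begin

lemma L2_zero_extend: "zero_extend S f \<in> L2 T \<longleftrightarrow> f \<in> L2 S"
proof -
  have "(\<lambda>x. (zero_extend S f x)\<^sup>2) = zero_extend S (\<lambda>x. (f x)\<^sup>2)"
    by (auto simp: zero_extend_def)
  then show ?thesis
    by (simp add: L2_def zero_extend_measurable[OF S T ST] zero_extend_integrable[OF S T ST])
qed

lemma L2_inner_zero_extend: "L2_inner T (zero_extend S f) g = L2_inner S f g"
proof -
  have "(\<lambda>x. zero_extend S f x * g x) = zero_extend S (\<lambda>x. f x * g x)"
    by (auto simp: zero_extend_def)
  then show ?thesis
    by (simp add: L2_inner_def zero_extend_integral[OF S T ST])
qed

lemma L2_norm_zero_extend: "L2_norm T (zero_extend S f) = L2_norm S f"
proof -
  have "(\<lambda>x. zero_extend S f x * zero_extend S f x) = zero_extend S (\<lambda>x. f x * f x)"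
    by (auto simp: zero_extend_def)
  then show ?thesis
    by (simp add: L2_norm_def L2_inner_def zero_extend_integral[OF S T ST])
qed

end

text \<open>Absolute continuity of the integral. The indicators need not converge pointwise, so
  dominated convergence is applied to truncations of |f| instead: the excess over k is small for
  large k uniformly in n, and the truncated part contributes at most k times the measure of
  \<open>A n\<close>.\<close>

lemma set_integral_tendsto_0:
  fixes f :: "'a \<Rightarrow> real"
  assumes f: "integrable M f" and A: "\<And>n. A n \<in> fmeasurable M"
    and lim: "(\<lambda>n. measure M (A n)) \<longlonglongrightarrow> 0"
  shows "(\<lambda>n. LINT x|M. indicator (A n) x * f x) \<longlonglongrightarrow> 0"
proof (rule LIMSEQ_I)
  fix e :: real assume "e > 0"
  have [measurable]: "f \<in> borel_measurable M" "A n \<in> sets M" for n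
    using f A by auto
  have int_min: "integrable M (\<lambda>x. min \<bar>f x\<bar> (real k))" for k
    by (rule Bochner_Integration.integrable_bound[OF f]) auto
  have "(\<lambda>k. LINT x|M. min \<bar>f x\<bar> (real k)) \<longlonglongrightarrow> (LINT x|M. \<bar>f x\<bar>)"
  proof (rule integral_dominated_convergence[where w = "\<lambda>x. \<bar>f x\<bar>"])
    show "AE x in M. (\<lambda>k. min \<bar>f x\<bar> (real k)) \<longlonglongrightarrow> \<bar>f x\<bar>"
    proof (rule AE_I2)
      fix x
      obtain N where "\<bar>f x\<bar> \<le> real N" using real_arch_simple by blast
      then show "(\<lambda>k. min \<bar>f x\<bar> (real k)) \<longlonglongrightarrow> \<bar>f x\<bar>"
        by (intro tendsto_eventually) (auto simp: eventually_sequentially intro!: exI[of _ N])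
    qed
  qed (use f in auto)
  then have "\<forall>\<^sub>F k in sequentially. dist (LINT x|M. min \<bar>f x\<bar> (real k)) (LINT x|M. \<bar>f x\<bar>) < e / 2"
    using \<open>e > 0\<close> by (auto dest!: tendstoD[where e = "e / 2"])
  then obtain k where "dist (LINT x|M. min \<bar>f x\<bar> (real k)) (LINT x|M. \<bar>f x\<bar>) < e / 2"
    using eventually_happens'[OF sequentially_bot] by blast
  then have k: "(LINT x|M. \<bar>f x\<bar>) - (LINT x|M. min \<bar>f x\<bar> (real k)) < e / 2"
    unfolding dist_real_def by linarith
  have "(\<lambda>n. real k * measure M (A n)) \<longlonglongrightarrow> real k * 0"
    by (intro tendsto_intros lim)
  then have "\<forall>\<^sub>F n in sequentially. dist (real k * measure M (A n)) 0 < e / 2"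
    using \<open>e > 0\<close> by (auto dest!: tendstoD[where e = "e / 2"])
  then obtain N where N: "\<And>n. n \<ge> N \<Longrightarrow> real k * measure M (A n) < e / 2"
    by (auto simp: dist_real_def eventually_sequentially)
  have "norm ((LINT x|M. indicator (A n) x * f x) - 0) < e" if "n \<ge> N" for n
  proof -
    have int_A: "integrable M (\<lambda>x. real k * indicator (A n) x)"
      using A[of n] by (auto simp: fmeasurable_def)
    have "norm (LINT x|M. indicator (A n) x * f x) \<le> (LINT x|M. norm (indicator (A n) x * f x))"
      by (rule integral_norm_bound)
    \<comment> \<open>On \<open>A n\<close> the minimum is at most k; off \<open>A n\<close> the
      left side is 0.\<close>
    also have "\<dots> \<le> (LINT x|M. \<bar>f x\<bar> - min \<bar>f x\<bar> (real k) + real k * indicator (A n) x)"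
    proof (rule integral_mono)
      show "integrable M (\<lambda>x. norm (indicator (A n) x * f x))"
        using integrable_mult_indicator[of "A n" M f] f by auto
      show "integrable M (\<lambda>x. \<bar>f x\<bar> - min \<bar>f x\<bar> (real k) + real k * indicator (A n) x)"
        using f int_min int_A by auto
    qed (auto simp: indicator_def)
    also have "\<dots> = (LINT x|M. \<bar>f x\<bar>) - (LINT x|M. min \<bar>f x\<bar> (real k)) + real k * measure M (A n)"
      using f int_min int_A A[of n] by (simp add: fmeasurableD)
    also have "\<dots> < e" using k N[OF that] by linarith
    finally show ?thesis by simp
  qed
  then show "\<exists>no. \<forall>n\<ge>no. norm ((LINT x|M. indicator (A n) x * f x) - 0) < e"
    by blast
qed

section \<open>Integration by parts against test functions\<close>

lemma smooth_differentiable: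
  assumes "smooth f"
  shows "f differentiable (at x)"
  using assms[unfolded smooth_def, rule_format, of "[]"] by simp

lemma smooth_partial: "smooth f \<Longrightarrow> smooth (partial j f)"
  unfolding smooth_def
proof (intro allI)
  fix js x
  assume "\<forall>js x. fold partial js f differentiable (at x)"
  from this[rule_format, of "j # js" x] show "fold partial js (partial j f) differentiable (at x)"
    by simp
qed

lemma smooth_continuous_on:
  assumes "smooth f"
  shows "continuous_on S f"
  by (intro continuous_at_imp_continuous_on ballI differentiable_imp_continuous_within
      smooth_differentiable assms)

lemma smooth_has_derivative: "smooth f \<Longrightarrow> (f has_derivative frechet_derivative f (at x)) (at x)"
  by (rule frechet_derivative_works[THEN iffD1, OF smooth_differentiable])

lemma partial_mult:
  assumes "smooth f" "smooth g"
  shows "partial j (\<lambda>x. f x * g x) = (\<lambda>x. f x * partial j g x + partial j f x * g x)"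
proof
  fix x
  show "partial j (\<lambda>x. f x * g x) x = f x * partial j g x + partial j f x * g x"
    using partial_eq[OF has_derivative_mult[OF smooth_has_derivative[OF assms(1)] smooth_has_derivative[OF assms(2)]]]
    by (simp add: partial_def)
qed

lemma eq_0_outside_support: "x \<notin> closure {x. f x \<noteq> 0} \<Longrightarrow> f x = 0"
  using subsetD[OF closure_subset[of "{x. f x \<noteq> 0}"], of x] by blast

lemma partial_eq_0_outside_support:
  assumes "x \<notin> closure {x. f x \<noteq> 0}"
  shows "partial j f x = 0"
proof -
  have "(f has_derivative (\<lambda>_. 0)) (at x)"
  proof (rule has_derivative_transform_within_open)
    show "((\<lambda>_. 0) has_derivative (\<lambda>_. 0)) (at x)"
      by (rule has_derivative_const)
    show "x \<in> - closure {x. f x \<noteq> 0}"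
      using assms by simp
    show "0 = f y" if "y \<in> - closure {x. f x \<noteq> 0}" for y
      by (rule eq_0_outside_support[symmetric]) (rule ComplD[OF that])
  qed (rule open_Compl[OF closed_closure])
  from partial_eq[OF this] show ?thesis .
qed

lemma integrable_compact_support:
  fixes f :: "'a::euclidean_space \<Rightarrow> real"
  assumes "continuous_on UNIV f" "compact K" "\<And>x. x \<notin> K \<Longrightarrow> f x = 0"
  shows "integrable lborel f"
proof -
  have "(\<lambda>x. indicator K x *\<^sub>R f x) = f"
    using assms(3) by (auto simp: fun_eq_iff indicator_def)
  then show ?thesis
    using borel_integrable_compact[OF assms(2) continuous_on_subset[OF assms(1) subset_UNIV]]
    by simp
qed

lemma differentiable_line_derivative:
  assumes "\<And>x. f differentiable (at x)"
  shows "((\<lambda>t. f (x + t *\<^sub>R axis j 1)) has_real_derivative partial j f (x + t *\<^sub>R axis j 1)) (at t)"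
proof -
  let ?D = "frechet_derivative f (at (x + t *\<^sub>R axis j 1))"
  have D: "(f has_derivative ?D) (at (x + t *\<^sub>R axis j 1))"
    by (rule frechet_derivative_works[THEN iffD1, OF assms])
  have "((\<lambda>t. f (x + t *\<^sub>R axis j 1)) has_derivative (\<lambda>h. ?D (h *\<^sub>R axis j 1))) (at t)"
    by (rule has_derivative_compose[where f = "\<lambda>t. x + t *\<^sub>R axis j 1" and g = f, OF _ D]) (auto intro!: derivative_eq_intros)
  moreover have "?D (h *\<^sub>R axis j 1) = partial j f (x + t *\<^sub>R axis j 1) * h" for h
    using linear_scale[OF has_derivative_linear[OF D]] by (simp add: partial_def)
  ultimately show ?thesis
    by (simp add: has_field_derivative_def)
qed

text \<open>The integrals of the difference quotients in direction \<open>j\<close> vanish by translation invariance.\<close>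

lemma integral_partial_eq_0:
  fixes f :: "real ^ 'd::finite \<Rightarrow> real"
  assumes diff: "\<And>x. f differentiable (at x)" and cont: "continuous_on UNIV (partial j f)"
    and supp: "compact (closure {x. f x \<noteq> 0})"
  shows "(LINT x|lborel. partial j f x) = 0"
proof -
  let ?e = "axis j 1 :: real ^ 'd"
  define h where "h n = 1 / real (Suc n)" for n
  define s where "s n x = (f (x + h n *\<^sub>R ?e) - f x) / h n" for n x
  have h: "h n > 0" "h n \<le> 1" for n by (auto simp: h_def)
  have "h \<longlonglongrightarrow> 0"
    unfolding h_def using LIMSEQ_Suc[OF lim_1_over_n] by simp
  have cont_f: "continuous_on UNIV f"
    by (intro continuous_at_imp_continuous_on ballI differentiable_imp_continuous_within diff)
  then have [measurable]: "f \<in> borel_measurable borel"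
    by (rule borel_measurable_continuous_onI)
  have [measurable]: "partial j f \<in> borel_measurable borel"
    using cont by (rule borel_measurable_continuous_onI)
  have int_f: "integrable lborel f"
    using cont_f supp eq_0_outside_support by (rule integrable_compact_support)
  \<comment> \<open>The mean value theorem serves twice: continuity of the partial derivative gives
    the pointwise limit, its bound gives the majorant.\<close>
  have mvt: "\<exists>z. 0 < z \<and> z < h n \<and> s n x = partial j f (x + z *\<^sub>R ?e)" for n x
    using MVT2[of 0 "h n" "\<lambda>t. f (x + t *\<^sub>R ?e)" "\<lambda>t. partial j f (x + t *\<^sub>R ?e)"]
      differentiable_line_derivative[OF diff] h[of n] by (force simp: s_def)
  let ?K = "closure {x. f x \<noteq> 0}"
  obtain R where "\<And>x. x \<in> ?K \<Longrightarrow> norm x \<le> R"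
    using compact_imp_bounded[OF supp] unfolding bounded_iff by blast
  then have R: "norm x \<le> R" if "f x \<noteq> 0" for x
    using eq_0_outside_support[of x f] that by blast
  have "compact (partial j f ` ?K)"
    by (intro compact_continuous_image supp continuous_on_subset[OF cont] subset_UNIV)
  from compact_imp_bounded[OF this] obtain b where b: "\<And>y. y \<in> partial j f ` ?K \<Longrightarrow> \<bar>y\<bar> \<le> b"
    unfolding bounded_iff real_norm_def by blast
  \<comment> \<open>The maximum with 0 covers points outside the support, where \<open>b\<close>
    says nothing.\<close>
  define B where "B = max b 0"
  have B: "\<bar>partial j f x\<bar> \<le> B" for x
  proof (cases "x \<in> ?K")
    case True
    then show ?thesis using b[OF imageI[OF True]] by (simp add: B_def)
  next
    case False
    then show ?thesis using partial_eq_0_outside_support[OF False] by (simp add: B_def)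
  qed
  have "(\<lambda>n. LINT x|lborel. s n x) \<longlonglongrightarrow> (LINT x|lborel. partial j f x)"
  \<comment> \<open>Shifts have length at most 1, so all quotients vanish outside the ball of radius
    R + 1.\<close>
  proof (rule integral_dominated_convergence[where w = "\<lambda>x. B * indicator (cball 0 (R + 1)) x"])
    show "AE x in lborel. (\<lambda>n. s n x) \<longlonglongrightarrow> partial j f x"
    proof (rule AE_I2)
      fix x
      have "\<forall>n. \<exists>z. 0 < z \<and> z < h n \<and> s n x = partial j f (x + z *\<^sub>R ?e)"
        using mvt by blast
      from choice[OF this] obtain z
        where z: "\<And>n. 0 < z n \<and> z n < h n \<and> s n x = partial j f (x + z n *\<^sub>R ?e)"
        by blast
      have "z \<longlonglongrightarrow> 0"
        by (rule tendsto_sandwich[OF _ _ tendsto_const \<open>h \<longlonglongrightarrow> 0\<close>]) (use z in \<open>auto simp: less_imp_le\<close>)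
      then have "(\<lambda>n. x + z n *\<^sub>R ?e) \<longlonglongrightarrow> x + 0 *\<^sub>R ?e"
        by (intro tendsto_intros)
      then have "(\<lambda>n. partial j f (x + z n *\<^sub>R ?e)) \<longlonglongrightarrow> partial j f x"
        using cont by (intro isCont_tendsto_compose[where g = "partial j f"])
          (auto simp: continuous_on_eq_continuous_at)
      then show "(\<lambda>n. s n x) \<longlonglongrightarrow> partial j f x"
        using z by simp
    qed
    show "AE x in lborel. norm (s n x) \<le> B * indicator (cball 0 (R + 1)) x" for n
    proof (rule AE_I2)
      fix x
      show "norm (s n x) \<le> B * indicator (cball 0 (R + 1)) x"
      proof (cases "norm x \<le> R + 1")
        case True
        then show ?thesis using mvt[of n x] B by auto
      next
        case False
        have "norm x - norm (h n *\<^sub>R ?e) \<le> norm (x + h n *\<^sub>R ?e)"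
          using norm_diff_ineq by blast
        moreover have "norm (h n *\<^sub>R ?e) \<le> 1"
          using h[of n] by simp
        ultimately have "f (x + h n *\<^sub>R ?e) = 0" "f x = 0"
          using R[of x] R[of "x + h n *\<^sub>R ?e"] False by (smt (verit))+
        then show ?thesis using False by (simp add: s_def)
      qed
    qed
    show "integrable lborel (\<lambda>x :: real ^ 'd. B * indicator (cball 0 (R + 1)) x)"
      by (intro integrable_mult_right integrable_real_indicator) (use emeasure_bounded_finite[OF bounded_cball, of "0 :: real ^ 'd" "R + 1"] in simp_all)
  qed (auto simp: s_def)
  moreover have "(LINT x|lborel. s n x) = 0" for n
  proof -
    let ?c = "h n *\<^sub>R ?e"
    have "integrable (distr lborel borel ((+) ?c)) f"
      using int_f by (simp add: lborel_distr_plus)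
    then have int: "integrable lborel (\<lambda>x. f (?c + x))"
      by (subst (asm) integrable_distr_eq) auto
    have "(LINT x|lborel. f x) = (LINT x|distr lborel borel ((+) ?c). f x)"
      by (simp add: lborel_distr_plus)
    also have "\<dots> = (LINT x|lborel. f (?c + x))"
      by (subst integral_distr) auto
    finally show ?thesis
      using int int_f by (simp add: s_def add.commute)
  qed
  ultimately show ?thesis
    by (simp add: LIMSEQ_const_iff)
qed

lemma test_function_smooth: "\<phi> \<in> test_functions \<Omega> \<Longrightarrow> smooth \<phi>"
  by (simp add: test_functions_def)

lemma test_function_eq_0:
  assumes "\<phi> \<in> test_functions \<Omega>" "x \<notin> \<Omega>"
  shows "\<phi> x = 0" "partial j \<phi> x = 0"
proof -
  have "x \<notin> closure {x. \<phi> x \<noteq> 0}"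
    using assms by (auto simp: test_functions_def)
  then show "\<phi> x = 0" "partial j \<phi> x = 0"
    by (rule eq_0_outside_support, rule partial_eq_0_outside_support)
qed

lemma test_functions_mono: "S \<subseteq> T \<Longrightarrow> test_functions S \<subseteq> test_functions T"
  by (auto simp: test_functions_def)

lemma L2_compact_support:
  assumes \<Omega>: "\<Omega> \<in> sets lebesgue" and cont: "continuous_on UNIV f"
    and K: "compact K" "\<And>x. x \<notin> K \<Longrightarrow> f x = 0"
  shows "f \<in> L2 \<Omega>"
proof -
  have [measurable]: "f \<in> borel_measurable borel"
    using cont by (rule borel_measurable_continuous_onI)
  then have "f \<in> borel_measurable (lebesgue_on \<Omega>)"
    by (intro measurable_restrict_space1 measurable_completion) simp
  moreover have "integrable lborel (\<lambda>x. (f x)\<^sup>2)"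
    using K by (intro integrable_compact_support[OF _ K(1)] continuous_intros cont) simp
  then have "integrable lebesgue (\<lambda>x. indicator \<Omega> x *\<^sub>R (f x)\<^sup>2)"
    using \<Omega> by (intro integrable_mult_indicator) (auto simp: integrable_completion)
  ultimately show ?thesis
    using \<Omega> by (simp add: L2_def integrable_restrict_space)
qed

text \<open>\<open>\<Omega>'\<close> may differ from \<open>\<Omega>\<close>: test functions of the
  larger set get paired with functions on the smaller one.\<close>

lemma test_function_L2:
  assumes "\<Omega> \<in> sets lebesgue" "\<phi> \<in> test_functions \<Omega>'"
  shows "\<phi> \<in> L2 \<Omega>" "partial j \<phi> \<in> L2 \<Omega>"
proof -
  have K: "compact (closure {x. \<phi> x \<noteq> 0})"
    using assms(2) by (simp add: test_functions_def)
  have s: "smooth \<phi>" by (rule test_function_smooth[OF assms(2)])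
  show "\<phi> \<in> L2 \<Omega>"
    by (rule L2_compact_support[OF assms(1) smooth_continuous_on[OF s] K])
       (rule eq_0_outside_support)
  show "partial j \<phi> \<in> L2 \<Omega>"
    by (rule L2_compact_support[OF assms(1) smooth_continuous_on[OF smooth_partial[OF s]] K])
       (rule partial_eq_0_outside_support)
qed

text \<open>The product has compact support because \<open>\<phi>\<close> has, so the integral of
  its partial derivative over the whole space vanishes. Leaving \<open>\<psi>\<close> merely smooth
  admits the constant 1 and test functions of larger sets.\<close>

lemma L2_inner_partial:
  assumes \<Omega>: "\<Omega> \<in> sets lebesgue" and \<phi>: "\<phi> \<in> test_functions \<Omega>" and \<psi>: "smooth \<psi>"
  shows "L2_inner \<Omega> \<phi> (partial j \<psi>) = - L2_inner \<Omega> (partial j \<phi>) \<psi>"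
proof -
  note s = test_function_smooth[OF \<phi>]
  let ?K = "closure {x. \<phi> x \<noteq> 0}"
  have K: "compact ?K"
    using \<phi> by (simp add: test_functions_def)
  have cont: "continuous_on UNIV \<phi>" "continuous_on UNIV \<psi>"
    "continuous_on UNIV (partial j \<phi>)" "continuous_on UNIV (partial j \<psi>)"
    by (intro smooth_continuous_on smooth_partial s \<psi>)+
  have supp: "closure {x. \<phi> x * \<psi> x \<noteq> 0} \<subseteq> ?K"
    by (intro closure_mono) auto
  have compact: "compact (closure {x. \<phi> x * \<psi> x \<noteq> 0})"
    using closed_Int_compact[OF closed_closure K, of "{x. \<phi> x * \<psi> x \<noteq> 0}"]
    unfolding Int_absorb2[OF supp] .
  \<comment> \<open>A first factor vanishing off \<open>\<Omega>\<close> turns the pairing into an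
    integral over the whole space, to which the vanishing result for \<open>lborel\<close>
    applies.\<close>
  have inner: "L2_inner \<Omega> f g = (LINT x|lborel. f x * g x)"
    if "\<And>x. x \<notin> \<Omega> \<Longrightarrow> f x = 0" "continuous_on UNIV f" "continuous_on UNIV g" for f g
  proof -
    have [measurable]: "f \<in> borel_measurable borel" "g \<in> borel_measurable borel"
      using that(2,3) by (auto intro: borel_measurable_continuous_onI)
    have "L2_inner \<Omega> f g = (LINT x|lebesgue. indicator \<Omega> x * (f x * g x))"
      using \<Omega> by (simp add: L2_inner_def integral_restrict_space)
    also have "\<dots> = (LINT x|lebesgue. f x * g x)"
      using that(1) by (intro Bochner_Integration.integral_cong) (auto simp: indicator_def)
    also have "\<dots> = (LINT x|lborel. f x * g x)"
      by (simp add: integral_completion)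
    finally show ?thesis .
  qed
  have "0 = (LINT x|lborel. partial j (\<lambda>x. \<phi> x * \<psi> x) x)"
  proof (rule integral_partial_eq_0[symmetric, OF _ _ compact])
    show "(\<lambda>x. \<phi> x * \<psi> x) differentiable (at x)" for x
      by (intro differentiable_mult smooth_differentiable s \<psi>)
    show "continuous_on UNIV (partial j (\<lambda>x. \<phi> x * \<psi> x))"
      unfolding partial_mult[OF s \<psi>] by (intro continuous_intros cont)
  qed
  also have "\<dots> = (LINT x|lborel. \<phi> x * partial j \<psi> x) + (LINT x|lborel. partial j \<phi> x * \<psi> x)"
  proof -
    have "integrable lborel (\<lambda>x. \<phi> x * partial j \<psi> x)"
    proof (rule integrable_compact_support[OF _ K])
      show "\<phi> x * partial j \<psi> x = 0" if "x \<notin> ?K" for x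
        by (simp add: eq_0_outside_support[OF that])
    qed (intro continuous_intros cont)
    moreover have "integrable lborel (\<lambda>x. partial j \<phi> x * \<psi> x)"
    proof (rule integrable_compact_support[OF _ K])
      show "partial j \<phi> x * \<psi> x = 0" if "x \<notin> ?K" for x
        by (simp add: partial_eq_0_outside_support[OF that])
    qed (intro continuous_intros cont)
    ultimately show ?thesis
      by (simp add: partial_mult[OF s \<psi>])
  qed
  finally show ?thesis
    using inner[of \<phi> "partial j \<psi>"] inner[of "partial j \<phi>" \<psi>] cont test_function_eq_0[OF \<phi>] by simp
qed

text \<open>Integration by parts against the constant 1.\<close>

lemma integral_partial_test_function:
  assumes \<Omega>: "\<Omega> \<in> sets lebesgue" and \<phi>: "\<phi> \<in> test_functions \<Omega>"
  shows "(LINT x|lebesgue_on \<Omega>. partial j \<phi> x) = 0"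
proof -
  have "smooth (\<lambda>x::real^'a. 1::real)"
    by (intro flat_algebra_smooth flat_algebra.const)
  from L2_inner_partial[OF assms this, of j] show ?thesis
    by (simp add: L2_inner_def partial_def)
qed

section \<open>Uniqueness of weak derivatives\<close>

text \<open>Boxes form an intersection-stable generator of the Borel sets, so vanishing integrals
  spread to all Borel sets by a Dynkin argument. Complements need the integral over the whole space,
  which is obtained first as a limit over growing boxes.\<close>

lemma AE_zero_if_integral_boxes_zero:
  fixes f :: "'a::euclidean_space \<Rightarrow> real"
  assumes f: "integrable lborel f"
    and boxes: "\<And>a b. (LINT x:box a b|lborel. f x) = 0"
  shows "AE x in lborel. f x = 0"
proof (rule sigma_finite_measure.density_zero[OF sigma_finite_lborel f])
  have [measurable]: "f \<in> borel_measurable borel"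
    using f by auto
  have sint: "set_integrable lborel A f" if "A \<in> sets lborel" for A
    using integrable_mult_indicator[OF that f] by (simp add: set_integrable_def)
  let ?B = "\<lambda>n. box (- (real n *\<^sub>R One)) (real n *\<^sub>R One) :: 'a set"
  have "(\<lambda>n. LINT x:?B n|lborel. f x) \<longlonglongrightarrow> (LINT x:UNIV|lborel. f x)"
    unfolding set_lebesgue_integral_def
  proof (rule integral_dominated_convergence[where w = "\<lambda>x. \<bar>f x\<bar>"])
    show "AE x in lborel. (\<lambda>n. indicator (?B n) x *\<^sub>R f x) \<longlonglongrightarrow> indicator UNIV x *\<^sub>R f x"
    proof (rule AE_I2)
      fix x :: 'a
      obtain N where N: "x \<in> ?B N"
        using UN_box_eq_UNIV by blast
      have "x \<in> ?B n" if "n \<ge> N" for n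
        using N that by (force simp: mem_box)
      then have "\<forall>\<^sub>F n in sequentially. indicator (?B n) x *\<^sub>R f x = indicator UNIV x *\<^sub>R f x"
        by (intro eventually_sequentiallyI[of N]) simp
      then show "(\<lambda>n. indicator (?B n) x *\<^sub>R f x) \<longlonglongrightarrow> indicator UNIV x *\<^sub>R f x"
        by (rule tendsto_eventually)
    qed
  qed (use f in \<open>auto simp: indicator_def\<close>)
  then have UNIV: "(LINT x:UNIV|lborel. f x) = 0"
    by (simp add: boxes LIMSEQ_const_iff)
  fix A :: "'a set" assume "A \<in> sets lborel"
  have "Int_stable (range (\<lambda>(a, b). box a b::'a set))"
    by (auto simp: Int_stable_def box_Int_box)
  moreover have "range (\<lambda>(a, b). box a b::'a set) \<subseteq> Pow UNIV"
    by simp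
  moreover have "A \<in> sigma_sets UNIV (range (\<lambda>(a, b). box a b::'a set))"
    using \<open>A \<in> sets lborel\<close> by (simp add: borel_eq_box)
  ultimately show "(LINT x:A|lborel. f x) = 0"
  proof (induction rule: sigma_sets_induct_disjoint)
    case (basic A)
    then show ?case using boxes by auto
  next
    case empty
    then show ?case by (simp add: set_lebesgue_integral_def)
  next
    case (compl A)
    then have A: "A \<in> sets lborel" by (simp add: borel_eq_box)
    then have "(LINT x:A \<union> (UNIV - A)|lborel. f x) = (LINT x:A|lborel. f x) + (LINT x:UNIV - A|lborel. f x)"
      by (intro set_integral_Un sint) auto
    then show ?case using UNIV compl by simp
  next
    case (union A)
    then have A: "A i \<in> sets lborel" for i by (auto simp: borel_eq_box)
    have "(LINT x:(\<Union>i. A i)|lborel. f x) = (\<Sum>i. LINT x:A i|lborel. f x)"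
      using union(1) A by (intro lebesgue_integral_countable_add sint) (auto simp: disjoint_family_on_def)
    then show ?case using union by simp
  qed
qed

text \<open>The Dynkin argument reaches only Borel sets, so \<open>f\<close> is replaced by a Borel
  function equal to it almost everywhere.\<close>

lemma AE_zero_if_integral_boxes_zero_lebesgue:
  fixes f :: "'a::euclidean_space \<Rightarrow> real"
  assumes f: "integrable lebesgue f"
    and boxes: "\<And>a b. (LINT x:box a b|lebesgue. f x) = 0"
  shows "AE x in lebesgue. f x = 0"
proof -
  obtain g where [measurable]: "g \<in> borel_measurable lborel" and ae: "AE x in lborel. f x = g x"
    using completion_ex_borel_measurable_real[OF borel_measurable_integrable[OF f]] by blast
  have fg: "AE x in lebesgue. f x = g x"
    using ae by (rule AE_completion)
  have [measurable]: "g \<in> borel_measurable lebesgue" "f \<in> borel_measurable lebesgue"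
    using f by (auto intro: measurable_completion borel_measurable_integrable)
  have "integrable lebesgue g"
    by (rule integrable_cong_AE_imp[OF f]) (use fg in \<open>auto elim: eventually_mono\<close>)
  then have g: "integrable lborel g"
    by (simp add: integrable_completion)
  have "AE x in lborel. g x = 0"
  proof (rule AE_zero_if_integral_boxes_zero[OF g])
    fix a b :: 'a
    have [measurable]: "box a b \<in> sets lebesgue" by auto
    have "(LINT x:box a b|lborel. g x) = (LINT x:box a b|lebesgue. g x)"
      by (simp add: set_lebesgue_integral_def integral_completion)
    also have "\<dots> = (LINT x:box a b|lebesgue. f x)"
      unfolding set_lebesgue_integral_def
      by (rule integral_cong_AE) (use fg in auto)
    finally show "(LINT x:box a b|lborel. g x) = 0"
      by (simp add: boxes)
  qed
  then have "AE x in lebesgue. g x = 0"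
    by (rule AE_completion)
  with fg show ?thesis by auto
qed

text \<open>Fundamental lemma of the calculus of variations, localised to boxes inside
  \<open>\<Omega>\<close>: there \<open>w\<close> is integrable, intersections with further boxes
  are again boxes inside \<open>\<Omega>\<close>, and countably many such boxes cover
  \<open>\<Omega>\<close>.\<close>

lemma AE_zero_if_orthogonal_to_test_functions:
  fixes w :: "real ^ 'd::finite \<Rightarrow> real"
  assumes "open \<Omega>" and w: "w \<in> L2 \<Omega>"
    and orth: "\<And>\<phi>. \<phi> \<in> test_functions \<Omega> \<Longrightarrow> L2_inner \<Omega> w \<phi> = 0"
  shows "AE x in lebesgue_on \<Omega>. w x = 0"
proof -
  have \<Omega>: "\<Omega> \<in> sets lebesgue" using \<open>open \<Omega>\<close> by auto
  have local: "AE x in lebesgue. x \<in> box a b \<longrightarrow> w x = 0" if ab: "box a b \<subseteq> \<Omega>" for a b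
  proof -
    have [measurable]: "(\<lambda>x. indicator \<Omega> x * w x) \<in> borel_measurable lebesgue"
      using w \<Omega> by (simp add: L2_def borel_measurable_restrict_space_iff)
    \<comment> \<open>The indicator of a bounded box is square integrable, so its product with
      \<open>w\<close> is integrable.\<close>
    have "zero_extend (box a b) (\<lambda>x. 1::real) \<in> L2 \<Omega>"
      using ab \<Omega> by (subst L2_zero_extend) (auto intro!: L2_const)
    from L2_inner_integrable[OF this w]
    have "integrable lebesgue (\<lambda>x. indicator \<Omega> x * (zero_extend (box a b) (\<lambda>x. 1) x * w x))"
      using \<Omega> by (simp add: integrable_restrict_space)
    also have "(\<lambda>x. indicator \<Omega> x * (zero_extend (box a b) (\<lambda>x. 1) x * w x)) = (\<lambda>x. indicator (box a b) x * w x)"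
      using ab by (auto simp: fun_eq_iff zero_extend_def indicator_def)
    finally have int: "integrable lebesgue (\<lambda>x. indicator (box a b) x * w x)" .
    have "AE x in lebesgue. indicator (box a b) x * w x = 0"
    proof (rule AE_zero_if_integral_boxes_zero_lebesgue[OF int])
      fix c d
      obtain e g where eg: "box c d \<inter> box a b = box e g"
        using box_Int_box[of c d a b] by blast
      then have "box e g \<subseteq> \<Omega>" using ab by blast
      then obtain \<phi> where test: "\<And>n. \<phi> n \<in> test_functions \<Omega>" and bound: "\<And>n x. \<bar>\<phi> n x\<bar> \<le> 1"
        and zero: "\<And>n x. x \<notin> box e g \<Longrightarrow> \<phi> n x = 0"
        and lim: "\<And>x. (\<lambda>n. \<phi> n x) \<longlonglongrightarrow> indicator (box e g) x"
        using box_indicator_limit_of_test_functions[of e g \<Omega>] by metis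
      have [measurable]: "\<phi> n \<in> borel_measurable lebesgue" for n
        using smooth_continuous_on[OF test_function_smooth[OF test]]
        by (intro measurable_completion) (simp add: borel_measurable_continuous_onI)
      have [measurable]: "box e g \<in> sets lebesgue" by auto
      have "(\<lambda>n. LINT x|lebesgue. \<phi> n x * (indicator \<Omega> x * w x)) \<longlonglongrightarrow>
            (LINT x|lebesgue. indicator (box e g) x * (indicator \<Omega> x * w x))"
      proof (rule integral_dominated_convergence[where w = "\<lambda>x. \<bar>indicator (box a b) x * w x\<bar>"])
        show "AE x in lebesgue. norm (\<phi> n x * (indicator \<Omega> x * w x)) \<le> \<bar>indicator (box a b) x * w x\<bar>" for n
        proof (rule AE_I2)
          fix x
          show "norm (\<phi> n x * (indicator \<Omega> x * w x)) \<le> \<bar>indicator (box a b) x * w x\<bar>"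
          proof (cases "x \<in> box e g")
            case True
            then have "x \<in> box a b" "x \<in> \<Omega>" using eg ab by blast+
            then show ?thesis
              using bound[of n x] by (simp add: abs_mult mult_left_le_one_le)
          qed (simp add: zero)
        qed
      qed (use int lim in \<open>auto intro!: tendsto_mult_right\<close>)
      moreover have "(LINT x|lebesgue. \<phi> n x * (indicator \<Omega> x * w x)) = 0" for n
        using orth[OF test, of n] \<Omega>
        by (simp add: L2_inner_def integral_restrict_space mult.left_commute mult.commute)
      ultimately have "(LINT x|lebesgue. indicator (box e g) x * (indicator \<Omega> x * w x)) = 0"
        by (simp add: LIMSEQ_const_iff)
      moreover have "(\<lambda>x. indicator (box c d) x *\<^sub>R (indicator (box a b) x * w x)) =
          (\<lambda>x. indicator (box e g) x * (indicator \<Omega> x * w x))"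
        using eg ab by (auto simp: indicator_def fun_eq_iff)
      ultimately show "(LINT x:box c d|lebesgue. indicator (box a b) x * w x) = 0"
        unfolding set_lebesgue_integral_def by metis
    qed
    then show ?thesis
      by (rule AE_mp) (auto simp: indicator_def)
  qed
  obtain \<D> where \<D>: "countable \<D>" "\<D> \<subseteq> Pow \<Omega>" "\<And>X. X \<in> \<D> \<Longrightarrow> \<exists>a b. X = box a b" "\<Union>\<D> = \<Omega>"
    using open_countable_Union_open_box[OF \<open>open \<Omega>\<close>] by metis
  have "AE x in lebesgue. \<forall>X\<in>\<D>. x \<in> X \<longrightarrow> w x = 0"
    unfolding AE_ball_countable[OF \<D>(1)] using \<D>(2,3) local by blast
  then show ?thesis
    using \<D>(4) \<Omega> by (auto simp: AE_restrict_space_iff elim!: eventually_mono)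
qed

lemma L2_add:
  assumes "f \<in> L2 \<Omega>" "g \<in> L2 \<Omega>"
  shows "(\<lambda>x. f x + g x) \<in> L2 \<Omega>"
proof -
  have "(\<lambda>x. 0) \<in> L2 \<Omega>" by (simp add: L2_def)
  from L2_diff[OF assms(1) L2_diff[OF this assms(2)]] show ?thesis by simp
qed

lemma L2_sum:
  assumes "finite I" "\<And>i. i \<in> I \<Longrightarrow> f i \<in> L2 \<Omega>"
  shows "(\<lambda>x. \<Sum>i\<in>I. f i x) \<in> L2 \<Omega>"
  using assms
proof (induction I)
  case empty
  show ?case by (simp add: L2_def)
next
  case (insert i I)
  then show ?case using L2_add[of "f i" \<Omega>] by simp
qed

text \<open>The difference of two weak derivatives is orthogonal to all test functions.\<close>

lemma has_weak_partial_unique: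
  assumes "open \<Omega>" "has_weak_partial \<Omega> j u w" "has_weak_partial \<Omega> j u w'"
  shows "AE x in lebesgue_on \<Omega>. w x = w' x"
proof -
  have \<Omega>: "\<Omega> \<in> sets lebesgue" using \<open>open \<Omega>\<close> by auto
  have w: "w \<in> L2 \<Omega>" "w' \<in> L2 \<Omega>"
    using assms by (auto simp: has_weak_partial_def)
  have "AE x in lebesgue_on \<Omega>. w x - w' x = 0"
  proof (rule AE_zero_if_orthogonal_to_test_functions[OF \<open>open \<Omega>\<close> L2_diff[OF w]])
    fix \<phi> assume \<phi>: "\<phi> \<in> test_functions \<Omega>"
    then have "L2_inner \<Omega> w \<phi> = L2_inner \<Omega> w' \<phi>"
      using assms by (auto simp: has_weak_partial_def)
    then show "L2_inner \<Omega> (\<lambda>x. w x - w' x) \<phi> = 0"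
      by (simp add: L2_inner_diff_left[OF w test_function_L2(1)[OF \<Omega> \<phi>]])
  qed
  then show ?thesis by simp
qed

section \<open>The chosen weak derivative and approximation by test functions\<close>

lemma has_weak_partial_weak_partial:
  "has_weak_partial \<Omega> j u w \<Longrightarrow> has_weak_partial \<Omega> j u (weak_partial \<Omega> j u)"
  unfolding weak_partial_def by (rule someI[of "has_weak_partial \<Omega> j u"])

lemma H1_has_weak_partial:
  assumes "u \<in> H1 \<Omega>"
  shows "has_weak_partial \<Omega> j u (weak_partial \<Omega> j u)"
  using assms unfolding H1_def by (blast intro: has_weak_partial_weak_partial)

lemma weak_partial_AE_eq:
  assumes "open \<Omega>" "has_weak_partial \<Omega> j u w"
  shows "AE x in lebesgue_on \<Omega>. weak_partial \<Omega> j u x = w x"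
  using has_weak_partial_unique[OF assms(1) has_weak_partial_weak_partial[OF assms(2)] assms(2)] .

text \<open>Lets any explicit weak derivative replace the arbitrary choice in
  \<open>weak_partial\<close> inside norms.\<close>

lemma weak_partial_L2_norm:
  assumes "open \<Omega>" "has_weak_partial \<Omega> j u w"
  shows "L2_norm \<Omega> (weak_partial \<Omega> j u) = L2_norm \<Omega> w"
  using assms has_weak_partial_weak_partial[OF assms(2)]
  by (intro L2_norm_cong_AE weak_partial_AE_eq) (auto simp: has_weak_partial_def L2_def)

text \<open>For a test function the classical partial derivative is a weak one, by integration by
  parts; the rest is linearity.\<close>

lemma has_weak_partial_diff_test_function:
  assumes "open \<Omega>" "has_weak_partial \<Omega> j u w" "\<phi> \<in> test_functions \<Omega>"
  shows "has_weak_partial \<Omega> j (\<lambda>x. u x - \<phi> x) (\<lambda>x. w x - partial j \<phi> x)"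
proof -
  have \<Omega>: "\<Omega> \<in> sets lebesgue" using \<open>open \<Omega>\<close> by auto
  note L2 = test_function_L2[OF \<Omega>]
  have uw: "u \<in> L2 \<Omega>" "w \<in> L2 \<Omega>"
    using assms by (auto simp: has_weak_partial_def)
  have "L2_inner \<Omega> (\<lambda>x. u x - \<phi> x) (partial j \<psi>) = - L2_inner \<Omega> (\<lambda>x. w x - partial j \<phi> x) \<psi>"
    if \<psi>: "\<psi> \<in> test_functions \<Omega>" for \<psi>
  proof -
    have "L2_inner \<Omega> u (partial j \<psi>) = - L2_inner \<Omega> w \<psi>"
      using assms(2) \<psi> by (auto simp: has_weak_partial_def)
    then show ?thesis
      using L2_inner_partial[OF \<Omega> assms(3) test_function_smooth[OF \<psi>], of j]
      by (simp add: L2_inner_diff_left[OF uw(1) L2(1)[OF assms(3)] L2(2)[OF \<psi>]]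
          L2_inner_diff_left[OF uw(2) L2(2)[OF assms(3)] L2(1)[OF \<psi>]])
  qed
  then show ?thesis
    using uw L2[OF assms(3)] by (auto simp: has_weak_partial_def intro!: L2_diff)
qed

text \<open>\<open>H1_0\<close> speaks of the chosen weak derivative of the difference, a choice
  made anew for each n. By uniqueness its norm is that of the difference of the derivatives, and
  each component is bounded by the seminorm.\<close>

lemma H1_0_approximation:
  assumes "open \<Omega>" "u \<in> H1_0 \<Omega>"
  obtains \<phi> where "\<And>n::nat. \<phi> n \<in> test_functions \<Omega>"
    "(\<lambda>n. L2_norm \<Omega> (\<lambda>x. u x - \<phi> n x)) \<longlonglongrightarrow> 0"
    "\<And>j. (\<lambda>n. L2_norm \<Omega> (\<lambda>x. weak_partial \<Omega> j u x - partial j (\<phi> n) x)) \<longlonglongrightarrow> 0"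
proof -
  obtain \<phi> where \<phi>: "\<And>n::nat. \<phi> n \<in> test_functions \<Omega>"
    and L2: "(\<lambda>n. L2_norm \<Omega> (\<lambda>x. u x - \<phi> n x)) \<longlonglongrightarrow> 0"
    and H1: "(\<lambda>n. H1_seminorm \<Omega> (\<lambda>x. u x - \<phi> n x)) \<longlonglongrightarrow> 0"
    using assms by (auto simp: H1_0_def)
  have u: "u \<in> H1 \<Omega>" using assms by (simp add: H1_0_def)
  show thesis
  proof (rule that[OF \<phi> L2])
    fix j
    have eq: "L2_norm \<Omega> (\<lambda>x. weak_partial \<Omega> j u x - partial j (\<phi> n) x)
        = L2_norm \<Omega> (weak_partial \<Omega> j (\<lambda>x. u x - \<phi> n x))" for n
      by (rule weak_partial_L2_norm[symmetric, OF assms(1)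
            has_weak_partial_diff_test_function[OF assms(1) H1_has_weak_partial[OF u] \<phi>]])
    show "(\<lambda>n. L2_norm \<Omega> (\<lambda>x. weak_partial \<Omega> j u x - partial j (\<phi> n) x)) \<longlonglongrightarrow> 0"
      unfolding eq
    proof (rule tendsto_sandwich[OF _ _ tendsto_const H1])
      have "(L2_norm \<Omega> (weak_partial \<Omega> j v))\<^sup>2 \<le> (\<Sum>j\<in>UNIV. (L2_norm \<Omega> (weak_partial \<Omega> j v))\<^sup>2)" for v
        by (rule member_le_sum) auto
      then show "\<forall>\<^sub>F n in sequentially. L2_norm \<Omega> (weak_partial \<Omega> j (\<lambda>x. u x - \<phi> n x))
          \<le> H1_seminorm \<Omega> (\<lambda>x. u x - \<phi> n x)"
        by (intro always_eventually allI) (simp only: H1_seminorm_def real_le_rsqrt)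
    qed (simp add: L2_norm_nonneg)
  qed
qed

section \<open>Extension by zero\<close>

text \<open>The approximants have compact support in \<open>S\<close>, so integrating them by parts
  against a test function of \<open>T\<close> leaves no term on the boundary of \<open>S\<close>;
  the identity survives the limit.\<close>

lemma zero_extend_has_weak_partial:
  assumes S: "open S" and T: "open T" and ST: "S \<subseteq> T"
    and uw: "u \<in> L2 S" "w \<in> L2 S" and \<phi>: "\<And>n::nat. \<phi> n \<in> test_functions S"
    and u_lim: "(\<lambda>n. L2_norm S (\<lambda>x. u x - \<phi> n x)) \<longlonglongrightarrow> 0"
    and w_lim: "(\<lambda>n. L2_norm S (\<lambda>x. w x - partial j (\<phi> n) x)) \<longlonglongrightarrow> 0"
  shows "has_weak_partial T j (zero_extend S u) (zero_extend S w)"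
proof -
  have sets: "S \<in> sets lebesgue" "T \<in> sets lebesgue" using S T by auto
  have "L2_inner S u (partial j \<psi>) = - L2_inner S w \<psi>" if \<psi>: "\<psi> \<in> test_functions T" for \<psi>
  proof (rule LIMSEQ_unique)
    note L2 = test_function_L2[OF sets(1)]
    show "(\<lambda>n. L2_inner S (\<phi> n) (partial j \<psi>)) \<longlonglongrightarrow> L2_inner S u (partial j \<psi>)"
      by (rule L2_inner_tendsto[OF uw(1) L2(1)[OF \<phi>] L2(2)[OF \<psi>] u_lim])
    have "(\<lambda>n. L2_inner S (partial j (\<phi> n)) \<psi>) \<longlonglongrightarrow> L2_inner S w \<psi>"
      by (rule L2_inner_tendsto[OF uw(2) L2(2)[OF \<phi>] L2(1)[OF \<psi>] w_lim])
    then show "(\<lambda>n. L2_inner S (\<phi> n) (partial j \<psi>)) \<longlonglongrightarrow> - L2_inner S w \<psi>"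
      unfolding L2_inner_partial[OF sets(1) \<phi> test_function_smooth[OF \<psi>]] by (rule tendsto_minus)
  qed
  then show ?thesis
    using uw by (simp add: has_weak_partial_def L2_zero_extend[OF sets ST] L2_inner_zero_extend[OF sets ST])
qed

text \<open>The approximants on \<open>S\<close> serve on \<open>T\<close> unchanged: they and their
  derivatives vanish off \<open>S\<close>, so the norms of the errors agree. The derivatives of
  \<open>u\<close> agree only almost everywhere, being chosen independently on the two sets.\<close>

lemma zero_extend_H1_0:
  assumes S: "open S" and T: "open T" and ST: "S \<subseteq> T" and u: "u \<in> H1_0 S"
  shows "zero_extend S u \<in> H1_0 T" (is ?H1_0)
    and "AE x in lebesgue_on T. weak_partial T j (zero_extend S u) x = zero_extend S (weak_partial S j u) x"
      (is ?AE)
proof -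
  have sets: "S \<in> sets lebesgue" "T \<in> sets lebesgue" using S T by auto
  obtain \<phi> where \<phi>: "\<And>n::nat. \<phi> n \<in> test_functions S"
    and u_lim: "(\<lambda>n. L2_norm S (\<lambda>x. u x - \<phi> n x)) \<longlonglongrightarrow> 0"
    and w_lim: "\<And>j. (\<lambda>n. L2_norm S (\<lambda>x. weak_partial S j u x - partial j (\<phi> n) x)) \<longlonglongrightarrow> 0"
    using that by (rule H1_0_approximation[OF S u])
  have "u \<in> H1 S" using u by (simp add: H1_0_def)
  then have L2: "u \<in> L2 S" "weak_partial S j u \<in> L2 S" for j
    using H1_has_weak_partial[of u S j] by (auto simp: has_weak_partial_def)
  have weak: "has_weak_partial T j (zero_extend S u) (zero_extend S (weak_partial S j u))" for j
    by (rule zero_extend_has_weak_partial[OF S T ST L2 \<phi> u_lim w_lim])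
  then show ?AE
    by (rule weak_partial_AE_eq[OF T])
  have H1: "zero_extend S u \<in> H1 T"
    using weak by (auto simp: H1_def has_weak_partial_def)
  have \<phi>T: "\<phi> n \<in> test_functions T" for n
    using \<phi> test_functions_mono[OF ST] by blast
  have "(\<lambda>x. zero_extend S u x - \<phi> n x) = zero_extend S (\<lambda>x. u x - \<phi> n x)" for n
    using test_function_eq_0(1)[OF \<phi>] by (auto simp: zero_extend_def)
  then have L2_lim: "(\<lambda>n. L2_norm T (\<lambda>x. zero_extend S u x - \<phi> n x)) \<longlonglongrightarrow> 0"
    using u_lim by (simp add: L2_norm_zero_extend[OF sets ST])
  have norm: "L2_norm T (weak_partial T j (\<lambda>x. zero_extend S u x - \<phi> n x))
      = L2_norm S (\<lambda>x. weak_partial S j u x - partial j (\<phi> n) x)" for j n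
  proof -
    have "(\<lambda>x. zero_extend S (weak_partial S j u) x - partial j (\<phi> n) x)
        = zero_extend S (\<lambda>x. weak_partial S j u x - partial j (\<phi> n) x)"
      using test_function_eq_0(2)[OF \<phi>] by (auto simp: zero_extend_def)
    then show ?thesis
      using weak_partial_L2_norm[OF T has_weak_partial_diff_test_function[OF T weak \<phi>T], of j n]
      by (simp add: L2_norm_zero_extend[OF sets ST])
  qed
  have "(\<lambda>n. H1_seminorm T (\<lambda>x. zero_extend S u x - \<phi> n x)) \<longlonglongrightarrow> sqrt (\<Sum>j\<in>(UNIV::'a set). 0\<^sup>2)"
    unfolding H1_seminorm_def norm by (intro tendsto_intros w_lim)
  then show ?H1_0
    using H1 \<phi>T L2_lim by (auto simp: H1_0_def)
qed

text \<open>The derivatives of the approximants have integral 0, and integration is pairing with the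
  constant 1, which is square integrable as the measure is finite.\<close>

lemma integral_weak_partial_eq_0:
  assumes "open \<Omega>" "\<Omega> \<in> lmeasurable" and u: "u \<in> H1_0 \<Omega>"
  shows "(LINT x|lebesgue_on \<Omega>. weak_partial \<Omega> j u x) = 0"
proof -
  have \<Omega>: "\<Omega> \<in> sets lebesgue" using \<open>open \<Omega>\<close> by auto
  obtain \<phi> where \<phi>: "\<And>n::nat. \<phi> n \<in> test_functions \<Omega>"
    and "(\<lambda>n. L2_norm \<Omega> (\<lambda>x. u x - \<phi> n x)) \<longlonglongrightarrow> 0"
    and w_lim: "\<And>j. (\<lambda>n. L2_norm \<Omega> (\<lambda>x. weak_partial \<Omega> j u x - partial j (\<phi> n) x)) \<longlonglongrightarrow> 0"
    using that by (rule H1_0_approximation[OF assms(1) u])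
  have "u \<in> H1 \<Omega>" using u by (simp add: H1_0_def)
  then have "weak_partial \<Omega> j u \<in> L2 \<Omega>"
    using H1_has_weak_partial[of u \<Omega> j] by (auto simp: has_weak_partial_def)
  from L2_inner_tendsto[OF this test_function_L2(2)[OF \<Omega> \<phi>] L2_const[OF assms(2), of 1] w_lim]
  show ?thesis
    by (simp add: L2_inner_def integral_partial_test_function[OF \<Omega> \<phi>] LIMSEQ_const_iff)
qed

lemma weak_div_L2:
  assumes "v \<in> H1_0_vec \<Omega>"
  shows "weak_div \<Omega> v \<in> L2 \<Omega>"
proof -
  have "weak_partial \<Omega> k (\<lambda>x. v x $ k) \<in> L2 \<Omega>" for k
    using assms H1_has_weak_partial[of "\<lambda>x. v x $ k" \<Omega> k]
    by (auto simp: H1_0_vec_def H1_0_def has_weak_partial_def)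
  then show ?thesis
    unfolding weak_div_def[abs_def] by (intro L2_sum) auto
qed

lemma integral_weak_div_eq_0:
  assumes "open \<Omega>" "\<Omega> \<in> lmeasurable" "v \<in> H1_0_vec \<Omega>"
  shows "(LINT x|lebesgue_on \<Omega>. weak_div \<Omega> v x) = 0"
proof -
  have "integrable (lebesgue_on \<Omega>) (weak_partial \<Omega> k (\<lambda>x. v x $ k))" for k
  proof -
    have "weak_partial \<Omega> k (\<lambda>x. v x $ k) \<in> L2 \<Omega>"
      using assms H1_has_weak_partial[of "\<lambda>x. v x $ k" \<Omega> k]
      by (auto simp: H1_0_vec_def H1_0_def has_weak_partial_def)
    from L2_inner_integrable[OF this L2_const[OF assms(2), of 1]] show ?thesis by simp
  qed
  then show ?thesis
    using assms by (simp add: weak_div_def integral_weak_partial_eq_0 H1_0_vec_def)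
qed

lemma zero_extend_vec_nth: "(\<lambda>x. zero_extend S v x $ k) = zero_extend S (\<lambda>x. v x $ k)"
  by (auto simp: zero_extend_def)

context
  fixes S T :: "(real ^ 'd::finite) set" and v :: "real ^ 'd \<Rightarrow> real ^ 'd"
  assumes S: "open S" and T: "open T" and ST: "S \<subseteq> T" and v: "v \<in> H1_0_vec S"
begin

lemma zero_extend_H1_0_vec: "zero_extend S v \<in> H1_0_vec T"
  using v by (simp add: H1_0_vec_def zero_extend_vec_nth zero_extend_H1_0(1)[OF S T ST])

lemma zero_extend_weak_partial_L2_norm:
  "L2_norm T (weak_partial T j (\<lambda>x. zero_extend S v x $ k)) = L2_norm S (weak_partial S j (\<lambda>x. v x $ k))"
proof -
  have sets: "S \<in> sets lebesgue" "T \<in> sets lebesgue" using S T by auto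
  have u: "(\<lambda>x. v x $ k) \<in> H1_0 S" using v by (simp add: H1_0_vec_def)
  have "L2_norm T (weak_partial T j (zero_extend S (\<lambda>x. v x $ k)))
      = L2_norm T (zero_extend S (weak_partial S j (\<lambda>x. v x $ k)))"
  proof (rule L2_norm_cong_AE[OF _ _ zero_extend_H1_0(2)[OF S T ST u]])
    have "weak_partial S j (\<lambda>x. v x $ k) \<in> L2 S"
      using u H1_has_weak_partial by (auto simp: H1_0_def has_weak_partial_def)
    then show "zero_extend S (weak_partial S j (\<lambda>x. v x $ k)) \<in> borel_measurable (lebesgue_on T)"
      by (simp add: zero_extend_measurable[OF sets ST] L2_def)
    have "weak_partial T j (zero_extend S (\<lambda>x. v x $ k)) \<in> L2 T"
      using zero_extend_H1_0(1)[OF S T ST u] H1_has_weak_partial by (auto simp: H1_0_def has_weak_partial_def)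
    then show "weak_partial T j (zero_extend S (\<lambda>x. v x $ k)) \<in> borel_measurable (lebesgue_on T)"
      by (simp add: L2_def)
  qed
  then show ?thesis
    by (simp add: zero_extend_vec_nth L2_norm_zero_extend[OF sets ST])
qed

lemma zero_extend_H1_seminorm_vec: "H1_seminorm_vec T (zero_extend S v) = H1_seminorm_vec S v"
  by (simp add: H1_seminorm_vec_def zero_extend_weak_partial_L2_norm)

lemma zero_extend_weak_div:
  assumes q: "q \<in> L2 T"
  shows "L2_inner T (weak_div T (zero_extend S v)) q = L2_inner S (weak_div S v) q"
proof -
  have sets: "S \<in> sets lebesgue" "T \<in> sets lebesgue" using S T by auto
  have "AE x in lebesgue_on T. weak_partial T k (\<lambda>x. zero_extend S v x $ k) x
      = zero_extend S (weak_partial S k (\<lambda>x. v x $ k)) x" for k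
    using v zero_extend_H1_0(2)[OF S T ST] by (simp add: zero_extend_vec_nth H1_0_vec_def)
  \<comment> \<open>The exceptional null sets of the finitely many components are merged.\<close>
  then have "AE x in lebesgue_on T. \<forall>k\<in>UNIV. weak_partial T k (\<lambda>x. zero_extend S v x $ k) x
      = zero_extend S (weak_partial S k (\<lambda>x. v x $ k)) x"
    by (subst AE_ball_countable) auto
  then have "AE x in lebesgue_on T. weak_div T (zero_extend S v) x = zero_extend S (weak_div S v) x"
    by eventually_elim (simp add: weak_div_def zero_extend_def)
  then have "L2_inner T (weak_div T (zero_extend S v)) q = L2_inner T (zero_extend S (weak_div S v)) q"
    using q weak_div_L2[OF zero_extend_H1_0_vec] weak_div_L2[OF v] unfolding L2_inner_def
    by (intro integral_cong_AE borel_measurable_times) (auto simp: L2_def zero_extend_measurable[OF sets ST])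
  then show ?thesis
    by (simp add: L2_inner_zero_extend[OF sets ST])
qed

lemma zero_extend_nonzero_on: "nonzero_on T (zero_extend S v) \<longleftrightarrow> nonzero_on S v"
proof -
  have "S \<in> sets lebesgue" "T \<in> sets lebesgue" using S T by auto
  from zero_extend_AE[OF this ST, of v "\<lambda>_. 0"] show ?thesis
    by (simp add: nonzero_on_def) (simp add: zero_extend_def)
qed

end

section \<open>The inf-sup constant\<close>

text \<open>Any constant \<open>c\<close> may be subtracted, because the divergence has integral 0.
  Zero extension preserves numerator and seminorm, so the two quotients differ only by the norms of
  \<open>q\<close> and of the shifted \<open>q\<close>.\<close>

lemma ratio_bounded_by_ereal_sup:
  assumes S: "open S" "S \<in> lmeasurable" and T: "open T" and ST: "S \<subseteq> T"
    and q: "q \<in> L2 T" and q_S: "q \<in> L2 S"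
    and v: "v \<in> H1_0_vec S" "nonzero_on S v"
    and N: "L2_norm T q > 0" "L2_norm S (\<lambda>x. q x - c) > 0"
  shows "ereal (L2_inner S (weak_div S v) (\<lambda>x. q x - c) / (H1_seminorm_vec S v * L2_norm S (\<lambda>x. q x - c)))
    \<le> ereal (L2_norm T q / L2_norm S (\<lambda>x. q x - c)) *
      (SUP v\<in>{v \<in> H1_0_vec T. nonzero_on T v}.
        ereal (L2_inner T (weak_div T v) q / (H1_seminorm_vec T v * L2_norm T q)))"
    (is "ereal ?r \<le> ereal ?c * (SUP v\<in>?V. ereal (?f v))")
proof -
  let ?v = "zero_extend S v"
  have "L2_inner S (\<lambda>x. q x - c) (weak_div S v) = L2_inner S q (weak_div S v) - L2_inner S (\<lambda>x. c) (weak_div S v)"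
    by (rule L2_inner_diff_left[OF q_S L2_const[OF S(2)] weak_div_L2[OF v(1)]])
  also have "L2_inner S (\<lambda>x. c) (weak_div S v) = 0"
    using integral_weak_div_eq_0[OF S v(1)] by (simp add: L2_inner_def)
  finally have "L2_inner S (weak_div S v) (\<lambda>x. q x - c) = L2_inner S (weak_div S v) q"
    by (simp add: L2_inner_commute)
  also have "\<dots> = L2_inner T (weak_div T ?v) q"
    by (rule zero_extend_weak_div[symmetric, OF S(1) T ST v(1) q])
  \<comment> \<open>Should the seminorm vanish, both sides are 0, as division by 0 gives 0.\<close>
  finally have "?r = ?c * ?f ?v"
    using N by (simp add: zero_extend_H1_seminorm_vec[OF S(1) T ST v(1)])
  moreover have "?v \<in> ?V"
    using zero_extend_H1_0_vec[OF S(1) T ST v(1)] zero_extend_nonzero_on[OF S(1) T ST v(1)] v(2) by simp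
  then have "ereal (?f ?v) \<le> (SUP v\<in>?V. ereal (?f v))"
    by (rule SUP_upper)
  then have "ereal ?c * ereal (?f ?v) \<le> ereal ?c * (SUP v\<in>?V. ereal (?f v))"
    by (rule ereal_mult_left_mono) (use N in simp)
  ultimately show ?thesis by simp
qed

lemma L2_norm_eq_0_iff:
  assumes "f \<in> L2 \<Omega>"
  shows "L2_norm \<Omega> f = 0 \<longleftrightarrow> (AE x in lebesgue_on \<Omega>. f x = 0)"
proof -
  have "L2_norm \<Omega> f = 0 \<longleftrightarrow> (LINT x|lebesgue_on \<Omega>. (f x)\<^sup>2) = 0"
    by (simp add: L2_norm_power2[symmetric])
  also have "\<dots> \<longleftrightarrow> (AE x in lebesgue_on \<Omega>. (f x)\<^sup>2 = 0)"
    using assms by (intro integral_nonneg_eq_0_iff_AE) (auto simp: L2_def)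
  finally show ?thesis by simp
qed

lemma L2_subset:
  assumes "S \<in> sets lebesgue" "T \<in> sets lebesgue" "S \<subseteq> T" "f \<in> L2 T"
  shows "f \<in> L2 S"
proof -
  have "f \<in> borel_measurable (lebesgue_on T)"
    using assms(4) by (simp add: L2_def)
  then have meas: "f \<in> borel_measurable (lebesgue_on S)"
    by (rule measurable_restrict_mono[OF _ assms(3)])
  have "integrable lebesgue (\<lambda>x. indicator T x *\<^sub>R (f x)\<^sup>2)"
    using assms(2,4) by (simp add: L2_def integrable_restrict_space)
  from integrable_mult_indicator[OF assms(1) this]
  have "integrable lebesgue (\<lambda>x. indicator S x *\<^sub>R (f x)\<^sup>2)"
    by (rule Bochner_Integration.integrable_cong[THEN iffD1, rotated 2])
       (use assms(3) in \<open>auto simp: indicator_def\<close>)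
  then have "integrable (lebesgue_on S) (\<lambda>x. (f x)\<^sup>2)"
    using assms(1) by (simp add: integrable_restrict_space)
  with meas show ?thesis
    by (simp add: L2_def)
qed

section \<open>Limits along the sets \<open>\<Omega>s n\<close>\<close>

context
  fixes \<Omega> :: "(real ^ 'd::finite) set" and \<Omega>s :: "nat \<Rightarrow> (real ^ 'd) set"
  assumes \<Omega>: "\<Omega> \<in> lmeasurable" and \<Omega>s: "\<And>n. \<Omega>s n \<in> sets lebesgue" and sub: "\<And>n. \<Omega>s n \<subseteq> \<Omega>"
    and lim: "(\<lambda>n. measure lebesgue (\<Omega> - \<Omega>s n)) \<longlonglongrightarrow> 0"
begin

text \<open>The error is the integral over \<open>\<Omega> - \<Omega>s n\<close>, which tends to 0
  by absolute continuity.\<close>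

lemma integral_exhaustion_tendsto:
  fixes f :: "real ^ 'd \<Rightarrow> real"
  assumes f: "integrable (lebesgue_on \<Omega>) f"
  shows "(\<lambda>n. LINT x|lebesgue_on (\<Omega>s n). f x) \<longlonglongrightarrow> (LINT x|lebesgue_on \<Omega>. f x)"
proof -
  have \<Omega>': "\<Omega> \<in> sets lebesgue" using \<Omega> by (rule fmeasurableD)
  have F: "integrable lebesgue (\<lambda>x. indicator \<Omega> x * f x)"
    using f \<Omega>' by (simp add: integrable_restrict_space)
  have D: "\<Omega> - \<Omega>s n \<in> lmeasurable" for n
    using \<Omega> \<Omega>s by (rule fmeasurable_Diff)
  have split: "(LINT x|lebesgue_on (\<Omega>s n). f x)
      = (LINT x|lebesgue_on \<Omega>. f x) - (LINT x|lebesgue. indicator (\<Omega> - \<Omega>s n) x * (indicator \<Omega> x * f x))" for n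
  proof -
    have "(LINT x|lebesgue_on (\<Omega>s n). f x) = (LINT x|lebesgue. indicator (\<Omega>s n) x * f x)"
      using \<Omega>s by (simp add: integral_restrict_space)
    also have "(\<lambda>x. indicator (\<Omega>s n) x * f x)
        = (\<lambda>x. indicator \<Omega> x * f x - indicator (\<Omega> - \<Omega>s n) x * (indicator \<Omega> x * f x))"
      using sub by (auto simp: indicator_def fun_eq_iff)
    also have "(LINT x|lebesgue. \<dots> x)
        = (LINT x|lebesgue. indicator \<Omega> x * f x) - (LINT x|lebesgue. indicator (\<Omega> - \<Omega>s n) x * (indicator \<Omega> x * f x))"
      using F integrable_mult_indicator[OF fmeasurableD[OF D] F] by (intro Bochner_Integration.integral_diff) auto
    finally show ?thesis
      using \<Omega>' by (simp add: integral_restrict_space)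
  qed
  have "(\<lambda>n. (LINT x|lebesgue_on \<Omega>. f x) - (LINT x|lebesgue. indicator (\<Omega> - \<Omega>s n) x * (indicator \<Omega> x * f x)))
      \<longlonglongrightarrow> (LINT x|lebesgue_on \<Omega>. f x) - 0"
    by (intro tendsto_diff tendsto_const set_integral_tendsto_0[OF F D lim])
  then show ?thesis by (simp add: split)
qed

text \<open>Subtracting the mean is an orthogonal projection, so the squared norm drops by exactly
  I^2 / m, with I the integral of \<open>q\<close> and m the measure of \<open>\<Omega>s n\<close>.
  Here I tends to 0 while m tends to a positive number.\<close>

lemma mean_corrected_L2_norm_tendsto:
  assumes q: "q \<in> L2_mean_zero \<Omega>" and pos: "measure lebesgue \<Omega> > 0"
    and pos_n: "\<And>n. measure lebesgue (\<Omega>s n) > 0"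
  shows "(\<lambda>n. L2_norm (\<Omega>s n) (\<lambda>x. q x - (LINT x|lebesgue_on (\<Omega>s n). q x) / measure lebesgue (\<Omega>s n)))
    \<longlonglongrightarrow> L2_norm \<Omega> q"
proof -
  define I m where "I n = (LINT x|lebesgue_on (\<Omega>s n). q x)" and "m n = measure lebesgue (\<Omega>s n)" for n
  have \<Omega>': "\<Omega> \<in> sets lebesgue" using \<Omega> by (rule fmeasurableD)
  have \<Omega>s': "\<Omega>s n \<in> lmeasurable" for n
    using fmeasurableI2[OF \<Omega> sub \<Omega>s] .
  have q_L2: "q \<in> L2 \<Omega>" and q_mean: "(LINT x|lebesgue_on \<Omega>. q x) = 0"
    using q by (auto simp: L2_mean_zero_def)
  have q_n: "q \<in> L2 (\<Omega>s n)" for n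
    using L2_subset[OF \<Omega>s \<Omega>' sub q_L2] .
  have norm: "(L2_norm (\<Omega>s n) (\<lambda>x. q x - I n / m n))\<^sup>2 = (LINT x|lebesgue_on (\<Omega>s n). (q x)\<^sup>2) - (I n)\<^sup>2 / m n" for n
  proof -
    have int: "integrable (lebesgue_on (\<Omega>s n)) (\<lambda>x. (q x)\<^sup>2)" "integrable (lebesgue_on (\<Omega>s n)) q"
        "integrable (lebesgue_on (\<Omega>s n)) (\<lambda>x. c)" for c :: real
      using q_n[of n] L2_inner_integrable[OF q_n L2_const[OF \<Omega>s'], of n 1]
        L2_inner_integrable[OF L2_const L2_const, OF \<Omega>s' \<Omega>s', of n c 1] by (auto simp: L2_def)
    have meas: "measure (lebesgue_on (\<Omega>s n)) (\<Omega>s n) = m n"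
      using \<Omega>s by (simp add: m_def measure_restrict_space)
    have "(L2_norm (\<Omega>s n) (\<lambda>x. q x - I n / m n))\<^sup>2
        = (LINT x|lebesgue_on (\<Omega>s n). (q x)\<^sup>2 - 2 * (I n / m n) * q x + (I n / m n)\<^sup>2)"
      unfolding L2_norm_power2 by (simp add: power2_diff algebra_simps)
    also have "\<dots> = (LINT x|lebesgue_on (\<Omega>s n). (q x)\<^sup>2) - 2 * (I n / m n) * I n + (I n / m n)\<^sup>2 * m n"
      using int meas by (simp add: I_def[symmetric])
    also have "\<dots> = (LINT x|lebesgue_on (\<Omega>s n). (q x)\<^sup>2) - (I n)\<^sup>2 / m n"
      using pos_n[of n] by (simp add: m_def field_simps power2_eq_square)
    finally show ?thesis .
  qed
  have int: "integrable (lebesgue_on \<Omega>) q" "integrable (lebesgue_on \<Omega>) (\<lambda>x. (q x)\<^sup>2)"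
    using q_L2 L2_inner_integrable[OF q_L2 L2_const[OF \<Omega>], of 1] by (auto simp: L2_def)
  have m_eq: "m = (\<lambda>n. measure lebesgue \<Omega> - measure lebesgue (\<Omega> - \<Omega>s n))"
    using measurable_measure_Diff[OF \<Omega> \<Omega>s sub] by (simp add: m_def fun_eq_iff)
  have m_lim: "m \<longlonglongrightarrow> measure lebesgue \<Omega>"
    using tendsto_diff[OF tendsto_const[of "measure lebesgue \<Omega>"] lim] by (simp add: m_eq)
  have I_lim: "I \<longlonglongrightarrow> 0"
    using integral_exhaustion_tendsto[OF int(1)] by (simp add: I_def[abs_def] q_mean)
  have "(\<lambda>n. sqrt ((LINT x|lebesgue_on (\<Omega>s n). (q x)\<^sup>2) - (I n)\<^sup>2 / m n))
      \<longlonglongrightarrow> sqrt ((LINT x|lebesgue_on \<Omega>. (q x)\<^sup>2) - 0\<^sup>2 / measure lebesgue \<Omega>)"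
    using pos
    by (intro tendsto_real_sqrt tendsto_diff tendsto_divide tendsto_power
        integral_exhaustion_tendsto[OF int(2)] m_lim I_lim) simp
  then show ?thesis
    unfolding real_sqrt_unique[OF norm L2_norm_nonneg]
    by (simp add: real_sqrt_unique[OF L2_norm_power2 L2_norm_nonneg] I_def m_def)
qed

end

theorem theorem2p2:
  fixes \<Omega> :: "(real ^ 'd::finite) set" and \<Omega>s :: "nat \<Rightarrow> (real ^ 'd) set"
  assumes "domain \<Omega>" and "bounded \<Omega>"
    and "\<And>n. domain (\<Omega>s n)"
    and "\<And>n. \<Omega>s n \<subseteq> \<Omega>"
    and "(\<lambda>n. measure lebesgue (\<Omega> - \<Omega>s n)) \<longlonglongrightarrow> 0"
  shows "limsup (\<lambda>n. inf_sup_constant (\<Omega>s n)) \<le> inf_sup_constant \<Omega>"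
proof -
  have op: "open \<Omega>" "open (\<Omega>s n)" and ne: "\<Omega> \<noteq> {}" "\<Omega>s n \<noteq> {}" for n
    using assms(1,3) by (auto simp: domain_def)
  have sets: "\<Omega> \<in> sets lebesgue" "\<Omega>s n \<in> sets lebesgue" for n
    using op by auto
  have lm: "\<Omega> \<in> lmeasurable"
    using assms(2) sets(1) by (rule bounded_set_imp_lmeasurable)
  have lm_n: "\<Omega>s n \<in> lmeasurable" for n
    using fmeasurableI2[OF lm assms(4) sets(2)] .
  \<comment> \<open>The means are quotients by these measures.\<close>
  have measure_pos: "measure lebesgue S > 0" if "open S" "S \<noteq> {}" "S \<in> lmeasurable" for S :: "(real ^ 'd) set"
    using open_not_negligible[OF that(1,2)] unfolding negligible_iff_measure0[OF that(3)] zero_less_measure_iff .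
  have pos: "measure lebesgue \<Omega> > 0" "measure lebesgue (\<Omega>s n) > 0" for n
    by (rule measure_pos[OF op(1) ne(1) lm], rule measure_pos[OF op(2) ne(2) lm_n])
  show ?thesis
    unfolding inf_sup_constant_def[of \<Omega>]
  proof (rule INF_greatest)
    fix q assume "q \<in> {q \<in> L2_mean_zero \<Omega>. nonzero_on \<Omega> q}"
    then have q: "q \<in> L2_mean_zero \<Omega>" "q \<in> L2 \<Omega>" and "nonzero_on \<Omega> q"
      by (auto simp: L2_mean_zero_def)
    then have N: "L2_norm \<Omega> q > 0"
      using L2_norm_eq_0_iff[OF q(2)] L2_norm_nonneg[of \<Omega> q] by (auto simp: nonzero_on_def)
    define c where "c n = (LINT x|lebesgue_on (\<Omega>s n). q x) / measure lebesgue (\<Omega>s n)" for n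
    define N' where "N' n = L2_norm (\<Omega>s n) (\<lambda>x. q x - c n)" for n
    define B where "B = (SUP v\<in>{v \<in> H1_0_vec \<Omega>. nonzero_on \<Omega> v}.
        ereal (L2_inner \<Omega> (weak_div \<Omega> v) q / (H1_seminorm_vec \<Omega> v * L2_norm \<Omega> q)))"
    have N'_lim: "N' \<longlonglongrightarrow> L2_norm \<Omega> q"
      unfolding N'_def c_def
      by (rule mean_corrected_L2_norm_tendsto[OF lm sets(2) assms(4,5) q(1) pos])
    \<comment> \<open>Positivity of \<open>N' n\<close> makes the corrected \<open>q\<close> nonzero
      and thus admissible on \<open>\<Omega>s n\<close>; it holds for large n, since
      \<open>N'\<close> tends to a positive limit.\<close>
    have bound: "inf_sup_constant (\<Omega>s n) \<le> ereal (L2_norm \<Omega> q / N' n) * B" if "N' n > 0" for n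
      unfolding inf_sup_constant_def
    proof (rule INF_lower2)
      have q_n: "q \<in> L2 (\<Omega>s n)"
        using L2_subset[OF sets(2,1) assms(4) q(2)] .
      have L2: "(\<lambda>x. q x - c n) \<in> L2 (\<Omega>s n)"
        by (rule L2_diff[OF q_n L2_const[OF lm_n]])
      have "integrable (lebesgue_on (\<Omega>s n)) q"
        using L2_inner_integrable[OF q_n L2_const[OF lm_n], of 1] by simp
      moreover have "integrable (lebesgue_on (\<Omega>s n)) (\<lambda>x. c n)"
        using L2_inner_integrable[OF L2_const L2_const, OF lm_n lm_n, of n "c n" 1] by simp
      moreover have "measure (lebesgue_on (\<Omega>s n)) (\<Omega>s n) = measure lebesgue (\<Omega>s n)"
        using sets by (simp add: measure_restrict_space)
      ultimately have "(LINT x|lebesgue_on (\<Omega>s n). q x - c n) = 0"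
        using pos(2)[of n] by (simp add: c_def)
      moreover have "nonzero_on (\<Omega>s n) (\<lambda>x. q x - c n)"
        using that L2_norm_eq_0_iff[OF L2] by (auto simp: nonzero_on_def N'_def)
      ultimately show "(\<lambda>x. q x - c n) \<in> {q \<in> L2_mean_zero (\<Omega>s n). nonzero_on (\<Omega>s n) q}"
        using L2 by (simp add: L2_mean_zero_def)
      show "(SUP v\<in>{v \<in> H1_0_vec (\<Omega>s n). nonzero_on (\<Omega>s n) v}.
          ereal (L2_inner (\<Omega>s n) (weak_div (\<Omega>s n) v) (\<lambda>x. q x - c n) /
            (H1_seminorm_vec (\<Omega>s n) v * L2_norm (\<Omega>s n) (\<lambda>x. q x - c n))))
          \<le> ereal (L2_norm \<Omega> q / N' n) * B"
      proof (rule SUP_least)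
        fix v assume "v \<in> {v \<in> H1_0_vec (\<Omega>s n). nonzero_on (\<Omega>s n) v}"
        then have v: "v \<in> H1_0_vec (\<Omega>s n)" "nonzero_on (\<Omega>s n) v" by simp_all
        show "ereal (L2_inner (\<Omega>s n) (weak_div (\<Omega>s n) v) (\<lambda>x. q x - c n) /
            (H1_seminorm_vec (\<Omega>s n) v * L2_norm (\<Omega>s n) (\<lambda>x. q x - c n)))
          \<le> ereal (L2_norm \<Omega> q / N' n) * B"
          unfolding N'_def B_def
          by (rule ratio_bounded_by_ereal_sup[OF op(2) lm_n op(1) assms(4) q(2) q_n v N
                that[unfolded N'_def]])
      qed
    qed
    have "\<forall>\<^sub>F n in sequentially. N' n > 0"
      using order_tendstoD(1)[OF N'_lim N] .
    then have "limsup (\<lambda>n. inf_sup_constant (\<Omega>s n)) \<le> limsup (\<lambda>n. ereal (L2_norm \<Omega> q / N' n) * B)"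
      by (intro Limsup_mono) (erule eventually_mono, erule bound)
    also have "\<dots> = B"
    proof (rule lim_imp_Limsup[OF sequentially_bot])
      have "(\<lambda>n. L2_norm \<Omega> q / N' n) \<longlonglongrightarrow> L2_norm \<Omega> q / L2_norm \<Omega> q"
        using N by (intro tendsto_divide tendsto_const N'_lim) simp
      then have "(\<lambda>n. ereal (L2_norm \<Omega> q / N' n)) \<longlonglongrightarrow> 1"
        using N by (simp add: one_ereal_def)
      \<comment> \<open>The finiteness of \<open>B\<close> has not been established; the product
        still converges because the other factor tends to 1, neither 0 nor infinite.\<close>
      from tendsto_mult_ereal[OF this tendsto_const[of B]]
      show "(\<lambda>n. ereal (L2_norm \<Omega> q / N' n) * B) \<longlonglongrightarrow> B"
        by simp
    qed
    finally show "limsup (\<lambda>n. inf_sup_constant (\<Omega>s n)) \<le> B" .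
  qed
qed

end
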